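(* Let $\mathscr{H}_S$ be a finite-dimensional complex Hilbert space, $\mathscr{H}_E$ a complex Hilbert space, $U_t$ a unitary operator on $\mathscr{H}_{SE}=\mathscr{H}_S\otimes\mathscr{H}_E$, $\rho_E$ a density operator on $\mathscr{H}_E$, and $\chi$ a Hermitian trace-class operator on $\mathscr{H}_{SE}$ with $\mathrm{Tr}_E\{\chi\}=0$ and $\mathrm{Tr}_S\{\chi\}=0$. For $X\in\mathcal{B}(\mathscr{H}_S)$ put $$\Phi_t[X]=\mathrm{Tr}_E\{U_t(X\otimes\rho_E)U_t^\dagger\},\qquad I_t^\chi=\mathrm{Tr}_E\{U_t\chi U_t^\dagger\},\qquad \Phi_t^\chi[X]=\Phi_t[X]+I_t^\chi .$$ Then the map $$\Psi_t^\chi[X]=\Phi_t[X]+I_t^\chi\,\mathrm{Tr}\{X\},\qquad X\in\mathcal{B}(\mathscr{H}_S),$$ is the unique linear map on $\mathcal{B}(\mathscr{H}_S)$ that coincides with $\Phi_t^\chi$ on the set of trace-one operators $\mathcal{A}^1(\mathscr{H}_S)$. Moreover, $\Psi_t^\chi$ is trace preserving, and it maps the physical domain into the set of states: $\Psi_t^\chi[\mathcal{P}_E^\chi(\mathscr{H}_S)]\subset\mathcal{S}(\mathscr{H}_S)$.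
   Context: $\mathcal{B}(\mathscr{H}_S)$ is the space of linear operators on $\mathscr{H}_S$; $\mathcal{S}(\mathscr{H})$ denotes the set of density operators (positive, trace one) on $\mathscr{H}$; $\mathcal{A}^1(\mathscr{H}_S)=\{X\in\mathcal{B}(\mathscr{H}_S)\mid\mathrm{Tr}\{X\}=1\}$. $\mathrm{Tr}_E$ and $\mathrm{Tr}_S$ are the partial traces over $\mathscr{H}_E$ and $\mathscr{H}_S$. The physical domain associated with the fixed environmental state $\rho_E$ and fixed correlation operator $\chi$ is $$\mathcal{P}_E^\chi(\mathscr{H}_S)=\{\rho_S\in\mathcal{S}(\mathscr{H}_S)\mid \rho_S\otimes\rho_E+\chi\geq 0\}.$$ *)

theory Defs
  imports "HOL-Analysis.Analysis" "HOL-Library.Function_Algebras" "HOL-Library.Nonpos_Ints"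
begin

section \<open>Complex Hilbert spaces\<close>

class scaleC =
  fixes scaleC :: "complex \<Rightarrow> 'a \<Rightarrow> 'a"  (infixr "*\<^sub>C" 75)

text \<open>The inner product is linear in its second argument. Completeness comes from \<open>banach\<close>.\<close>

class chilbert_space = scaleC + banach +
  fixes cinner :: "'a \<Rightarrow> 'a \<Rightarrow> complex"
  assumes scaleC_add_right: "a *\<^sub>C (x + y) = a *\<^sub>C x + a *\<^sub>C y"
    and scaleC_add_left: "(a + b) *\<^sub>C x = a *\<^sub>C x + b *\<^sub>C x"
    and scaleC_scaleC: "a *\<^sub>C (b *\<^sub>C x) = (a * b) *\<^sub>C x"
    and scaleC_one: "1 *\<^sub>C x = x"
    and scaleR_scaleC: "r *\<^sub>R x = complex_of_real r *\<^sub>C x"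
    and cinner_commute: "cinner x y = cnj (cinner y x)"
    and cinner_add_right: "cinner x (y + z) = cinner x y + cinner x z"
    and cinner_scaleC_right: "cinner x (a *\<^sub>C y) = a * cinner x y"
    and cinner_ge_zero: "0 \<le> Re (cinner x x)"
    and norm_eq_sqrt_cinner: "norm x = sqrt (Re (cinner x x))"

global_interpretation complex_vector:
  vector_space "scaleC :: complex \<Rightarrow> 'a \<Rightarrow> 'a::chilbert_space"
  by unfold_locales (simp_all add: scaleC_add_right scaleC_add_left scaleC_scaleC scaleC_one)

instantiation "fun" :: (type, scaleC) scaleC
begin
definition scaleC_fun :: "complex \<Rightarrow> ('a \<Rightarrow> 'b) \<Rightarrow> 'a \<Rightarrow> 'b"
  where "scaleC_fun c f = (\<lambda>x. c *\<^sub>C f x)"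
instance ..
end

definition is_onb :: "'a::chilbert_space set \<Rightarrow> bool"
  where "is_onb B \<longleftrightarrow> (\<forall>e\<in>B. \<forall>f\<in>B. cinner e f = (if e = f then 1 else 0))
           \<and> closure (complex_vector.span B) = UNIV"

text \<open>The traces below are evaluated in this basis; their values do not depend on it.\<close>

definition some_onb :: "'a::chilbert_space set"
  where "some_onb = (SOME B. is_onb B)"


section \<open>Operators\<close>

abbreviation clinear :: "('a::chilbert_space \<Rightarrow> 'b::chilbert_space) \<Rightarrow> bool"
  where "clinear \<equiv> Vector_Spaces.linear scaleC scaleC"

definition bounded_clinear :: "('a::chilbert_space \<Rightarrow> 'b::chilbert_space) \<Rightarrow> bool"
  where "bounded_clinear A \<longleftrightarrow> clinear A \<and> (\<exists>K. \<forall>x. norm (A x) \<le> K * norm x)"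

definition adj :: "('a::chilbert_space \<Rightarrow> 'b::chilbert_space) \<Rightarrow> 'b \<Rightarrow> 'a"
  where "adj A = (THE B. \<forall>x y. cinner (B x) y = cinner x (A y))"

definition unitary_op :: "('a::chilbert_space \<Rightarrow> 'a) \<Rightarrow> bool"
  where "unitary_op U \<longleftrightarrow> bounded_clinear U \<and> adj U \<circ> U = id \<and> U \<circ> adj U = id"

definition hermitian_op :: "('a::chilbert_space \<Rightarrow> 'a) \<Rightarrow> bool"
  where "hermitian_op A \<longleftrightarrow> bounded_clinear A \<and> adj A = A"

definition positive_op :: "('a::chilbert_space \<Rightarrow> 'a) \<Rightarrow> bool"
  where "positive_op A \<longleftrightarrow> bounded_clinear A \<and> (\<forall>x. cinner x (A x) \<in> \<real>\<^sub>\<ge>\<^sub>0)"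

text \<open>The operator \<open>P\<close> is the modulus of \<open>A\<close>, the positive square root of
  \<open>adj A \<circ> A\<close>, so the condition says that the modulus has finite trace.\<close>

definition trace_class_op :: "('a::chilbert_space \<Rightarrow> 'a) \<Rightarrow> bool"
  where "trace_class_op A \<longleftrightarrow> bounded_clinear A
           \<and> (\<exists>P. positive_op P \<and> P \<circ> P = adj A \<circ> A \<and> (\<lambda>e. cinner e (P e)) summable_on some_onb)"

definition op_trace :: "('a::chilbert_space \<Rightarrow> 'a) \<Rightarrow> complex"
  where "op_trace A = (\<Sum>\<^sub>\<infinity>e\<in>some_onb. cinner e (A e))"

definition density_ops :: "('a::chilbert_space \<Rightarrow> 'a) set"
  where "density_ops = {\<rho>. positive_op \<rho> \<and> trace_class_op \<rho> \<and> op_trace \<rho> = 1}"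

text \<open>Used only for finite-dimensional spaces, where linear operators are bounded.\<close>

definition linear_ops :: "('a::chilbert_space \<Rightarrow> 'a) set"
  where "linear_ops = {X. clinear X}"

definition trace_one_ops :: "('a::chilbert_space \<Rightarrow> 'a) set"
  where "trace_one_ops = {X \<in> linear_ops. op_trace X = 1}"

definition linear_map_on_ops ::
    "(('a::chilbert_space \<Rightarrow> 'a) \<Rightarrow> ('a \<Rightarrow> 'a)) \<Rightarrow> bool"
  where "linear_map_on_ops \<Lambda> \<longleftrightarrow>
           (\<forall>X\<in>linear_ops. \<Lambda> X \<in> linear_ops)
         \<and> (\<forall>X\<in>linear_ops. \<forall>Y\<in>linear_ops. \<Lambda> (X + Y) = \<Lambda> X + \<Lambda> Y)
         \<and> (\<forall>c. \<forall>X\<in>linear_ops. \<Lambda> (c *\<^sub>C X) = c *\<^sub>C \<Lambda> X)"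


section \<open>Tensor products and partial traces\<close>

text \<open>The Hilbert space tensor product is unique only up to unitary isomorphism. Here
  \<open>'k\<close> together with the map \<open>tens\<close> of elementary tensors is any realization of it.\<close>

definition is_hilbert_tensor ::
    "('s::chilbert_space \<Rightarrow> 'e::chilbert_space \<Rightarrow> 'k::chilbert_space) \<Rightarrow> bool"
  where "is_hilbert_tensor tens \<longleftrightarrow>
           (\<forall>x. clinear (tens x)) \<and> (\<forall>y. clinear (\<lambda>x. tens x y))
         \<and> (\<forall>x y x' y'. cinner (tens x y) (tens x' y') = cinner x x' * cinner y y')
         \<and> closure (complex_vector.span {tens x y |x y. True}) = UNIV"

definition op_tensor ::
    "('s::chilbert_space \<Rightarrow> 'e::chilbert_space \<Rightarrow> 'k::chilbert_space)
      \<Rightarrow> ('s \<Rightarrow> 's) \<Rightarrow> ('e \<Rightarrow> 'e) \<Rightarrow> 'k \<Rightarrow> 'k"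
  where "op_tensor tens A B =
           (THE T. bounded_clinear T \<and> (\<forall>x y. T (tens x y) = tens (A x) (B y)))"

text \<open>Partial traces over the second and the first factor, given by their matrix elements.\<close>

definition ptrace_E ::
    "('s::chilbert_space \<Rightarrow> 'e::chilbert_space \<Rightarrow> 'k::chilbert_space)
      \<Rightarrow> ('k \<Rightarrow> 'k) \<Rightarrow> 's \<Rightarrow> 's"
  where "ptrace_E tens T =
           (THE A. \<forall>\<phi> \<psi>. cinner \<phi> (A \<psi>)
              = (\<Sum>\<^sub>\<infinity>f\<in>some_onb. cinner (tens \<phi> f) (T (tens \<psi> f))))"

definition ptrace_S ::
    "('s::chilbert_space \<Rightarrow> 'e::chilbert_space \<Rightarrow> 'k::chilbert_space)
      \<Rightarrow> ('k \<Rightarrow> 'k) \<Rightarrow> 'e \<Rightarrow> 'e"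
  where "ptrace_S tens T =
           (THE A. \<forall>\<phi> \<psi>. cinner \<phi> (A \<psi>)
              = (\<Sum>\<^sub>\<infinity>e\<in>some_onb. cinner (tens e \<phi>) (T (tens e \<psi>))))"


section \<open>Reduced dynamics\<close>

definition Phi ::
    "('s::chilbert_space \<Rightarrow> 'e::chilbert_space \<Rightarrow> 'k::chilbert_space)
      \<Rightarrow> ('k \<Rightarrow> 'k) \<Rightarrow> ('e \<Rightarrow> 'e) \<Rightarrow> ('s \<Rightarrow> 's) \<Rightarrow> 's \<Rightarrow> 's"
  where "Phi tens U \<rho>\<^sub>E X = ptrace_E tens (U \<circ> op_tensor tens X \<rho>\<^sub>E \<circ> adj U)"

definition I_chi ::
    "('s::chilbert_space \<Rightarrow> 'e::chilbert_space \<Rightarrow> 'k::chilbert_space)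
      \<Rightarrow> ('k \<Rightarrow> 'k) \<Rightarrow> ('k \<Rightarrow> 'k) \<Rightarrow> 's \<Rightarrow> 's"
  where "I_chi tens U chi = ptrace_E tens (U \<circ> chi \<circ> adj U)"

definition Phi_chi ::
    "('s::chilbert_space \<Rightarrow> 'e::chilbert_space \<Rightarrow> 'k::chilbert_space)
      \<Rightarrow> ('k \<Rightarrow> 'k) \<Rightarrow> ('e \<Rightarrow> 'e) \<Rightarrow> ('k \<Rightarrow> 'k) \<Rightarrow> ('s \<Rightarrow> 's) \<Rightarrow> 's \<Rightarrow> 's"
  where "Phi_chi tens U \<rho>\<^sub>E chi X = Phi tens U \<rho>\<^sub>E X + I_chi tens U chi"

definition Psi_chi ::
    "('s::chilbert_space \<Rightarrow> 'e::chilbert_space \<Rightarrow> 'k::chilbert_space)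
      \<Rightarrow> ('k \<Rightarrow> 'k) \<Rightarrow> ('e \<Rightarrow> 'e) \<Rightarrow> ('k \<Rightarrow> 'k) \<Rightarrow> ('s \<Rightarrow> 's) \<Rightarrow> 's \<Rightarrow> 's"
  where "Psi_chi tens U \<rho>\<^sub>E chi X = Phi tens U \<rho>\<^sub>E X + op_trace X *\<^sub>C I_chi tens U chi"

definition physical_domain ::
    "('s::chilbert_space \<Rightarrow> 'e::chilbert_space \<Rightarrow> 'k::chilbert_space)
      \<Rightarrow> ('e \<Rightarrow> 'e) \<Rightarrow> ('k \<Rightarrow> 'k) \<Rightarrow> ('s \<Rightarrow> 's) set"
  where "physical_domain tens \<rho>\<^sub>E chi =
           {\<rho>\<^sub>S \<in> density_ops. positive_op (op_tensor tens \<rho>\<^sub>S \<rho>\<^sub>E + chi)}"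

end

theory Submission
  imports Defs
begin

text \<open>
  On trace-one operators \<open>Psi_chi\<close> and \<open>Phi_chi\<close> agree, and every operator on the
  system is a combination of trace-one operators; so uniqueness is linear algebra. The analytic
  content is that all partial traces converge and that the trace of an operator on \<open>'k\<close>
  may be computed in any orthonormal basis, in particular in the bases obtained from a product basis
  by unitaries; then \<open>op_trace \<circ> ptrace_E = op_trace\<close>, and the trace of \<open>I_chi\<close> is
  that of \<open>ptrace_E chi = 0\<close>.

  Basis independence is proved for positive operators without square roots: a Cholesky elimination
  along a finite part of one basis bounds the finite partial traces in any other orthonormal system.
  It extends to linear combinations of positive operators of finite trace (\<open>nuclear\<close>
  below). A Hermitian trace-class \<open>A\<close> is one, because \<open>A \<le> P\<close> and
  \<open>- A \<le> P\<close> for the modulus \<open>P\<close> of \<open>A\<close>, and \<open>X \<otimes> \<rho>\<close> is one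
  by polarization in the first factor.
\<close>

subsection \<open>Inner products and bounded operators\<close>


text \<open>The usual proof of basis independence factors a positive \<open>T\<close> as
  \<open>B* B\<close> and swaps a double sum. Such a factorization is needed here only on the span
  of a finite set \<open>G\<close>: there elimination turns \<open>T\<close> into a Gram sum of
  rank-one terms, since the remainder vanishes on \<open>G\<close>, and Bessel's inequality bounds
  the swapped sum. Letting \<open>G\<close> exhaust one basis gives an inequality between two bases,
  and exchanging the bases gives equality.

  Adjoints, tensor operators and partial traces are defined by \<open>THE\<close>, and a divergent
  infinite sum is 0 by convention. Hence existence and convergence come before any calculation.
  \<open>nuclear\<close> is the condition that secures the convergence; it survives unitary
  conjugation and the addition of \<open>chi\<close>. Finite dimension of the system enters where an
  operator on it is rebuilt from its matrix elements and where \<open>X \<otimes> \<rho>\<close> is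
  split into finitely many terms; the environment may have any dimension.\<close>

lemma clinear_iff: "clinear f \<longleftrightarrow> (\<forall>x y. f (x + y) = f x + f y) \<and> (\<forall>c x. f (c *\<^sub>C x) = c *\<^sub>C f x)"
  by (simp add: Vector_Spaces.linear_iff_module_hom module_hom_iff
      complex_vector.module_axioms)

lemma cinner_add_left: "cinner (x + y) z = cinner x z + cinner y z"
  by (metis cinner_add_right cinner_commute complex_cnj_add)

lemma cinner_scaleC_left [simp]: "cinner (a *\<^sub>C x) y = cnj a * cinner x y"
  by (metis cinner_commute cinner_scaleC_right complex_cnj_mult)

lemmas [simp] = cinner_scaleC_right

lemma cinner_zero [simp]: "cinner x 0 = 0" "cinner 0 x = 0"
  using cinner_scaleC_right[of x 0 0] cinner_scaleC_left[of 0 0 x] by simp_all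

lemma cinner_minus [simp]: "cinner x (- y) = - cinner x y" "cinner (- x) y = - cinner x y"
  using cinner_add_right[of x y "- y"] cinner_add_left[of x "- x" y]
  by (simp_all add: add_eq_0_iff)

lemma cinner_diff_right: "cinner x (y - z) = cinner x y - cinner x z"
  using cinner_add_right[of x y "- z"] by simp

lemma cinner_diff_left: "cinner (y - z) x = cinner y x - cinner z x"
  using cinner_add_left[of y "- z" x] by simp

lemmas cinner_simps = cinner_add_left cinner_add_right cinner_diff_left cinner_diff_right

lemma cinner_sum_right: "cinner x (sum f I) = (\<Sum>i\<in>I. cinner x (f i))"
  by (induction I rule: infinite_finite_induct) (simp_all add: cinner_add_right)

lemma cinner_sum_left: "cinner (sum f I) x = (\<Sum>i\<in>I. cinner (f i) x)"
  by (induction I rule: infinite_finite_induct) (simp_all add: cinner_add_left)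

lemma cinner_self: "cinner x x = of_real ((norm x)\<^sup>2)"
proof (rule complex_eqI)
  show "Re (cinner x x) = Re (complex_of_real ((norm x)\<^sup>2))"
    by (simp add: norm_eq_sqrt_cinner cinner_ge_zero)
  have "Im (cinner x x) = - Im (cinner x x)"
    using arg_cong[OF cinner_commute[of x x], of Im] by simp
  then show "Im (cinner x x) = Im (complex_of_real ((norm x)\<^sup>2))" by simp
qed

lemma Re_cinner_self [simp]: "Re (cinner x x) = (norm x)\<^sup>2"
  by (simp add: cinner_self del: of_real_power)

lemma cinner_self_eq_0 [simp]: "cinner x x = 0 \<longleftrightarrow> x = 0"
  by (simp add: cinner_self)

lemma norm_cinner_commute: "cmod (cinner x y) = cmod (cinner y x)"
  by (metis cinner_commute complex_mod_cnj)

lemma cinner_ext: "x = y" if "\<And>z. cinner z x = cinner z y"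
proof -
  have "cinner (x - y) (x - y) = 0" using that by (simp add: cinner_diff_right)
  then show ?thesis by simp
qed

lemma cinner_ext_left: "x = y" if "\<And>z. cinner x z = cinner y z"
  by (rule cinner_ext) (metis that cinner_commute)

text \<open>The class axioms give homogeneity of the norm for real scalars only; the complex case
  comes from the inner product.\<close>

lemma norm_scaleC [simp]:
  fixes x :: "'a::chilbert_space"
  shows "norm (c *\<^sub>C x) = cmod c * norm x"
proof -
  have "(norm (c *\<^sub>C x))\<^sup>2 = Re (cinner (c *\<^sub>C x) (c *\<^sub>C x))" by (simp only: Re_cinner_self)
  also have "\<dots> = Re ((c * cnj c) * cinner x x)" by (simp only: cinner_scaleC_left cinner_scaleC_right mult_ac)
  also have "\<dots> = (cmod c * norm x)\<^sup>2"
    by (simp add: cinner_self complex_mult_cnj cmod_power2 power_mult_distrib)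
  finally show ?thesis by (simp add: power2_eq_iff_nonneg)
qed

lemma norm_add_square: "(norm (x + y))\<^sup>2 = (norm x)\<^sup>2 + 2 * Re (cinner x y) + (norm y)\<^sup>2"
proof -
  have "(norm (x + y))\<^sup>2 = Re (cinner (x + y) (x + y))" by simp
  also have "\<dots> = (norm x)\<^sup>2 + (Re (cinner x y) + Re (cinner y x)) + (norm y)\<^sup>2"
    by (simp add: cinner_simps)
  also have "Re (cinner y x) = Re (cinner x y)" 
    using arg_cong[OF cinner_commute[of y x], of Re] by simp
  finally show ?thesis by simp
qed

lemma bounded_clinear_add: "bounded_clinear A \<Longrightarrow> A (x + y) = A x + A y"
  and bounded_clinear_scaleC: "bounded_clinear A \<Longrightarrow> A (c *\<^sub>C x) = c *\<^sub>C A x"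
  by (simp_all add: bounded_clinear_def clinear_iff)

lemma bounded_clinear_bounded_linear:
  assumes "bounded_clinear A"
  shows "bounded_linear A"
proof -
  obtain K where "\<And>x. norm (A x) \<le> K * norm x"
    using assms by (auto simp: bounded_clinear_def)
  then show ?thesis
    by (intro bounded_linear_intro[where K=K])
      (simp_all add: assms bounded_clinear_add bounded_clinear_scaleC scaleR_scaleC mult.commute)
qed

lemma bounded_clinear_zero [simp]: "bounded_clinear A \<Longrightarrow> A 0 = 0"
  and bounded_clinear_diff: "bounded_clinear A \<Longrightarrow> A (x - y) = A x - A y"
  and bounded_clinear_sum: "bounded_clinear A \<Longrightarrow> A (sum g I) = (\<Sum>i\<in>I. A (g i))"
  using linear_0 linear_diff linear_sum bounded_linear.linear bounded_clinear_bounded_linear by blast+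

lemma bounded_clinear_bound: "bounded_clinear A \<Longrightarrow> \<exists>K>0. \<forall>x. norm (A x) \<le> K * norm x"
  using bounded_linear.pos_bounded[OF bounded_clinear_bounded_linear] by (auto simp: mult.commute)

lemma bounded_clinearI:
  assumes "\<And>x y. A (x + y) = A x + A y" "\<And>c x. A (c *\<^sub>C x) = c *\<^sub>C A x"
    and "\<And>x. norm (A x) \<le> K * norm x"
  shows "bounded_clinear A"
  using assms by (auto simp: bounded_clinear_def clinear_iff)

lemma bounded_clinear_of_bounded_linear:
  assumes "bounded_linear A" "\<And>c x. A (c *\<^sub>C x) = c *\<^sub>C A x"
  shows "bounded_clinear A"
  using bounded_linear.bounded[OF assms(1)] assms(2) linear_add[OF bounded_linear.linear[OF assms(1)]]
  by (auto simp: mult.commute intro!: bounded_clinearI)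

lemma bounded_clinear_plus:
  "bounded_clinear A \<Longrightarrow> bounded_clinear B \<Longrightarrow> bounded_clinear (\<lambda>x. A x + B x)"
  by (rule bounded_clinear_of_bounded_linear)
    (simp_all add: bounded_linear_add bounded_clinear_bounded_linear bounded_clinear_scaleC scaleC_add_right)

lemma bounded_clinear_scale:
  assumes "bounded_clinear A"
  shows "bounded_clinear (\<lambda>x. c *\<^sub>C A x)"
proof -
  obtain K where "\<And>x. norm (A x) \<le> K * norm x" using bounded_clinear_bound[OF assms] by auto
  then have "norm (c *\<^sub>C A x) \<le> (cmod c * K) * norm x" for x
    using mult_left_mono[of "norm (A x)" _ "cmod c"] by (simp add: mult.assoc)
  then show ?thesis
    by (intro bounded_clinearI[where K="cmod c * K"])
      (simp_all add: assms bounded_clinear_add bounded_clinear_scaleC scaleC_add_right scaleC_scaleC mult.commute)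
qed

lemma bounded_clinear_minus:
  "bounded_clinear A \<Longrightarrow> bounded_clinear B \<Longrightarrow> bounded_clinear (\<lambda>x. A x - B x)"
  using bounded_clinear_plus[OF _ bounded_clinear_scale[of B "-1"], of A] by simp

lemma bounded_clinear_comp:
  "bounded_clinear A \<Longrightarrow> bounded_clinear B \<Longrightarrow> bounded_clinear (\<lambda>x. A (B x))"
  by (rule bounded_clinear_of_bounded_linear)
    (simp_all add: bounded_linear_compose bounded_clinear_bounded_linear bounded_clinear_scaleC)

lemma bounded_clinear_id: "bounded_clinear (\<lambda>x. x)"
  by (rule bounded_clinearI[of _ 1]) simp_all

lemma bounded_clinear_const_zero: "bounded_clinear (\<lambda>x. 0)"
  by (rule bounded_clinearI[of _ 1]) simp_all

lemma bounded_clinear_finite_sum: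
  "(\<And>i. i \<in> I \<Longrightarrow> bounded_clinear (F i)) \<Longrightarrow> bounded_clinear (\<lambda>x. \<Sum>i\<in>I. F i x)"
  by (induction I rule: infinite_finite_induct)
    (simp_all add: bounded_clinear_const_zero bounded_clinear_plus)

section \<open>Positive operators: symmetry and the Cauchy-Schwarz inequality\<close>

lemma positive_op_iff:
  "positive_op A \<longleftrightarrow> bounded_clinear A \<and> (\<forall>x. 0 \<le> Re (cinner x (A x)) \<and> Im (cinner x (A x)) = 0)"
  by (simp add: positive_op_def complex_nonneg_Reals_iff)

lemma positive_op_bounded_clinear: "positive_op T \<Longrightarrow> bounded_clinear T"
  and positive_op_Re: "positive_op T \<Longrightarrow> 0 \<le> Re (cinner x (T x))"
  and positive_op_Im: "positive_op T \<Longrightarrow> Im (cinner x (T x)) = 0"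
  by (simp_all add: positive_op_iff)

lemma positive_op_cinner: "positive_op T \<Longrightarrow> cinner x (T x) = of_real (Re (cinner x (T x)))"
  by (simp add: complex_eq_iff positive_op_Im)

text \<open>Polarization: the quadratic form is real at \<open>x + y\<close> and at
  \<open>x + \<i> *\<^sub>C y\<close>, which fixes the imaginary and the real part of
  \<open>cinner x (T y)\<close> in terms of \<open>cinner y (T x)\<close>.\<close>

lemma positive_op_symmetric:
  assumes "positive_op T"
  shows "cinner (T x) y = cinner x (T y)"
proof -
  note lin = bounded_clinear_add[OF positive_op_bounded_clinear[OF assms]]
    bounded_clinear_scaleC[OF positive_op_bounded_clinear[OF assms]]
  have "Im (cinner (x + y) (T (x + y))) = 0" "Im (cinner (x + \<i> *\<^sub>C y) (T (x + \<i> *\<^sub>C y))) = 0"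
    using positive_op_Im[OF assms] by blast+
  then have "Im (cinner x (T y)) + Im (cinner y (T x)) = 0" "Re (cinner x (T y)) - Re (cinner y (T x)) = 0"
    using positive_op_Im[OF assms, of x] positive_op_Im[OF assms, of y]
    by (simp_all add: lin cinner_simps)
  then have "cinner x (T y) = cnj (cinner y (T x))" by (simp add: complex_eq_iff)
  then show ?thesis by (simp add: cinner_commute[of "T x"])
qed

lemma positive_op_Cauchy_Schwarz:
  assumes "positive_op T"
  shows "(cmod (cinner x (T y)))\<^sup>2 \<le> Re (cinner x (T x)) * Re (cinner y (T y))"
proof -
  define a p q where "a = cinner x (T y)" and "p = Re (cinner x (T x))" and "q = Re (cinner y (T y))"
  note lin = bounded_clinear_add[OF positive_op_bounded_clinear[OF assms]]
    bounded_clinear_scaleC[OF positive_op_bounded_clinear[OF assms]]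
  have yx: "cinner y (T x) = cnj a"
    by (simp add: a_def positive_op_symmetric[OF assms, of x y, symmetric] cinner_commute[of y])
  have xx: "cinner x (T x) = of_real p" and yy: "cinner y (T y) = of_real q"
    unfolding p_def q_def using positive_op_cinner[OF assms] by blast+
  have key: "0 \<le> p - 2 * t * (cmod a)\<^sup>2 + t\<^sup>2 * (cmod a)\<^sup>2 * q" for t :: real
  proof -
    \<comment> \<open>The factor \<open>cnj a\<close> aligns the phases, so both cross terms become
      the real number \<open>- t * |a|^2\<close> and a real quadratic in \<open>t\<close>
      remains.\<close>
    define c where "c = - (of_real t * cnj a)"
    have "0 \<le> Re (cinner (x + c *\<^sub>C y) (T (x + c *\<^sub>C y)))"
      by (rule positive_op_Re[OF assms])
    also have "\<dots> = p + Re (c * a) + Re (cnj c * cnj a) + Re (cnj c * (c * q))"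
      unfolding lin cinner_simps cinner_scaleC_left cinner_scaleC_right xx yy yx a_def[symmetric]
      by (simp add: algebra_simps)
    also have "\<dots> = p - 2 * t * (cmod a)\<^sup>2 + t\<^sup>2 * (cmod a)\<^sup>2 * q"
      unfolding cmod_power2 by (simp add: c_def algebra_simps power2_eq_square)
    finally show ?thesis .
  qed
  have "p \<ge> 0" "q \<ge> 0" using positive_op_Re[OF assms] by (simp_all add: p_def q_def)
  show ?thesis
  proof (cases "q = 0")
    case True
    have "a = 0"
    proof (rule ccontr)
      assume "a \<noteq> 0"
      \<comment> \<open>If \<open>q = 0\<close>, the bound is affine in \<open>t\<close>; this
        choice of \<open>t\<close> would give it the value -1.\<close>
      then have "2 * ((p + 1) / (2 * (cmod a)\<^sup>2)) * (cmod a)\<^sup>2 = p + 1" by (simp add: field_simps)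
      with key[of "(p + 1) / (2 * (cmod a)\<^sup>2)"] True show False by simp
    qed
    then show ?thesis using \<open>p \<ge> 0\<close> \<open>q \<ge> 0\<close> by (simp flip: a_def p_def q_def)
  next
    case False
    then have "q > 0" using \<open>q \<ge> 0\<close> by simp
    have "0 \<le> p - (cmod a)\<^sup>2 / q"
      using key[of "1 / q"] False by (simp add: field_simps power2_eq_square)
    then have "(cmod a)\<^sup>2 \<le> p * q" using \<open>q > 0\<close> by (simp add: field_simps)
    then show ?thesis by (simp flip: a_def p_def q_def)
  qed
qed

lemma cinner_Cauchy_Schwarz: "cmod (cinner x y) \<le> norm x * norm y"
proof (rule power2_le_imp_le)
  have "positive_op (\<lambda>x::'a. x)" by (simp add: positive_op_iff bounded_clinear_id cinner_self)
  from positive_op_Cauchy_Schwarz[OF this, of x y]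
  show "(cmod (cinner x y))\<^sup>2 \<le> (norm x * norm y)\<^sup>2"
    by (simp add: cinner_self power_mult_distrib)
qed simp

lemma bounded_bilinear_cinner: "bounded_bilinear cinner"
proof
  show "\<exists>K. \<forall>a b. norm (cinner a b) \<le> norm a * norm b * K"
    by (rule exI[of _ 1]) (simp add: cinner_Cauchy_Schwarz)
qed (simp_all add: cinner_simps scaleR_scaleC scaleR_conv_of_real)

subsection \<open>Orthogonal projection, adjoints and orthonormal bases\<close>

text \<open>A minimizing sequence for the distance is Cauchy by the parallelogram law and converges
  by completeness. At a nearest point no displacement inside \<open>M\<close> can shorten the
  distance, which forces orthogonality.\<close>

lemma ex_orthogonal_projection:
  fixes x :: "'a::chilbert_space"
  assumes M: "complex_vector.subspace M" and "closed M"
  shows "\<exists>m\<in>M. \<forall>y\<in>M. cinner y (x - m) = 0"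
proof -
  have "M \<noteq> {}" using complex_vector.subspace_0[OF M] by auto
  define d where "d = infdist x M"
  have d: "d \<le> dist x m" if "m \<in> M" for m unfolding d_def using that by (rule infdist_le)
  have "d \<ge> 0" by (simp add: d_def infdist_nonneg)
  have "\<exists>m\<in>M. dist x m < d + 1 / Suc n" for n
    using \<open>M \<noteq> {}\<close> unfolding d_def infdist_def
    by (simp add: cInf_less_iff[symmetric] del: of_nat_Suc)
       (metis (no_types, lifting) bdd_belowI2 cINF_less_iff less_add_same_cancel1 of_nat_0_less_iff
         zero_le_dist zero_less_Suc zero_less_divide_1_iff)
  then obtain m where m: "\<And>n. m n \<in> M" "\<And>n. dist x (m n) < d + 1 / Suc n" by metis
  \<comment> \<open>Parallelogram law for \<open>x - m p\<close> and \<open>x - m q\<close>; the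
    midpoint of \<open>m p\<close> and \<open>m q\<close> lies in \<open>M\<close>, so the sum of
    the two vectors has norm at least \<open>2 * d\<close>.\<close>
  have half: "(norm (m p - m q))\<^sup>2 \<le> 2 * (dist x (m p))\<^sup>2 + 2 * (dist x (m q))\<^sup>2 - 4 * d\<^sup>2" for p q
  proof -
    define u v where "u = x - m p" and "v = x - m q"
    have par: "(norm (u + v))\<^sup>2 + (norm (v - u))\<^sup>2 = 2 * (norm u)\<^sup>2 + 2 * (norm v)\<^sup>2"
      using norm_add_square[of u v] norm_add_square[of v "- u"] cinner_commute[of u v] by simp
    have "(1/2) *\<^sub>C (m p + m q) \<in> M"
      by (intro complex_vector.subspace_scale complex_vector.subspace_add M m)
    from d[OF this] have "d \<le> norm ((1/2) *\<^sub>C (u + v))"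
      by (simp add: u_def v_def dist_norm algebra_simps scaleC_add_right complex_vector.scale_right_diff_distrib)
        (simp add: scaleC_add_left[symmetric])
    then have "2 * d \<le> norm (u + v)" by simp
    then have "(2 * d)\<^sup>2 \<le> (norm (u + v))\<^sup>2" using \<open>d \<ge> 0\<close> by (intro power_mono) auto
    with par show ?thesis by (simp add: u_def v_def dist_norm)
  qed
  have "Cauchy m"
  proof (rule metric_CauchyI)
    fix e :: real assume "e > 0"
    have "(\<lambda>n. 4 * (d + 1 / Suc n)\<^sup>2 - 4 * d\<^sup>2) \<longlonglongrightarrow> 4 * (d + 0)\<^sup>2 - 4 * d\<^sup>2"
      by (intro tendsto_intros LIMSEQ_Suc[OF lim_1_over_n])
    then have "eventually (\<lambda>n. 4 * (d + 1 / Suc n)\<^sup>2 - 4 * d\<^sup>2 < e\<^sup>2) sequentially"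
      using \<open>e > 0\<close> by (intro order_tendstoD) auto
    then obtain N where N: "4 * (d + 1 / Suc N)\<^sup>2 - 4 * d\<^sup>2 < e\<^sup>2"
      by (auto simp: eventually_sequentially)
    have bd: "(dist x (m n))\<^sup>2 \<le> (d + 1 / Suc N)\<^sup>2" if "n \<ge> N" for n
    proof (rule power_mono)
      have "1 / real (Suc n) \<le> 1 / real (Suc N)" using that by (simp add: frac_le)
      then show "dist x (m n) \<le> d + 1 / Suc N" using m(2)[of n] by linarith
    qed simp
    show "\<exists>N. \<forall>p\<ge>N. \<forall>q\<ge>N. dist (m p) (m q) < e"
    proof (intro exI[of _ N] allI impI)
      fix p q assume "p \<ge> N" "q \<ge> N"
      then have "(norm (m p - m q))\<^sup>2 < e\<^sup>2" using half[of p q] bd[of p] bd[of q] N by linarith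
      then show "dist (m p) (m q) < e" using \<open>e > 0\<close> by (simp add: dist_norm power2_less_imp_less)
    qed
  qed
  then obtain z where z: "m \<longlonglongrightarrow> z" using Cauchy_convergent_iff convergent_def by blast
  have "z \<in> M" using closed_sequentially[OF \<open>closed M\<close> m(1) z] .
  have "(\<lambda>n. dist x (m n)) \<longlonglongrightarrow> dist x z" by (intro tendsto_intros z)
  moreover have "(\<lambda>n. d + 1 / Suc n) \<longlonglongrightarrow> d + 0"
    by (intro tendsto_intros LIMSEQ_Suc[OF lim_1_over_n])
  ultimately have xz: "dist x z \<le> d"
    using LIMSEQ_le[of "\<lambda>n. dist x (m n)" "dist x z" "\<lambda>n. d + 1 / Suc n" d] m(2) by (auto intro: less_imp_le)
  have "cinner y (x - z) = 0" if "y \<in> M" for y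
  proof (cases "y = 0")
    case False
    \<comment> \<open>\<open>c *\<^sub>C y\<close> is the projection of \<open>x - z\<close> onto
      the line of \<open>y\<close>; moving by it lowers the squared distance by
      \<open>|a|^2 / |y|^2\<close>.\<close>
    define a c where "a = cinner y (x - z)" and "c = a / of_real ((norm y)\<^sup>2)"
    have "z + c *\<^sub>C y \<in> M"
      by (intro complex_vector.subspace_scale complex_vector.subspace_add M that \<open>z \<in> M\<close>)
    from d[OF this] have "norm (x - z) \<le> norm ((x - z) + (- c) *\<^sub>C y)"
      using xz by (simp add: dist_norm algebra_simps)
    then have "(norm (x - z))\<^sup>2 \<le> (norm ((x - z) + (- c) *\<^sub>C y))\<^sup>2" by (intro power_mono) auto
    also have "\<dots> = (norm (x - z))\<^sup>2 + 2 * Re (- c * cnj a) + (cmod c)\<^sup>2 * (norm y)\<^sup>2"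
      unfolding norm_add_square cinner_scaleC_right a_def cinner_commute[of "x - z" y]
      by (simp add: power_mult_distrib)
    also have "Re (- c * cnj a) = - ((cmod a)\<^sup>2 / (norm y)\<^sup>2)"
    proof -
      have "c * cnj a = of_real ((cmod a)\<^sup>2 / (norm y)\<^sup>2)"
        unfolding c_def of_real_divide complex_norm_square by simp
      then show ?thesis by simp
    qed
    also have "(cmod c)\<^sup>2 * (norm y)\<^sup>2 = (cmod a)\<^sup>2 / (norm y)\<^sup>2"
      using False by (simp add: c_def norm_divide norm_mult power_divide power2_eq_square)
    finally have "(cmod a)\<^sup>2 / (norm y)\<^sup>2 \<le> 0" by simp
    then have "a = 0" using False by (simp add: divide_le_0_iff)
    then show ?thesis by (simp add: a_def)
  qed simp
  with \<open>z \<in> M\<close> show ?thesis by blast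
qed


text \<open>Kernels of bounded functionals, used for Riesz and for orthogonal complements. Linearity
  is spelled out because \<open>complex\<close> is not made an instance of
  \<open>chilbert_space\<close>.\<close>

lemma closed_complex_subspaceI:
  assumes "\<And>x. x \<in> M \<longleftrightarrow> f x = 0" and "\<And>x y. f (x + y) = f x + f y"
    and "\<And>c x. f (c *\<^sub>C x) = c * f x" and "bounded_linear f"
  shows "complex_vector.subspace M \<and> closed M"
proof
  have "f 0 = 0" using assms(3)[of 0 0] by simp
  then show "complex_vector.subspace M"
    by (auto simp: complex_vector.subspace_def assms(1-3))
  have "closed (f -` {0})"
    by (intro continuous_closed_vimage) (auto intro: bounded_linear.continuous[OF assms(4)])
  moreover have "M = f -` {0}" using assms(1) by auto
  ultimately show "closed M" by simp
qed

text \<open>The kernel of a nonzero \<open>f\<close> has an orthogonal vector \<open>z\<close> with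
  \<open>f z\<close> nonzero; subtracting the right multiple of \<open>z\<close> puts any
  \<open>x\<close> in the kernel, so a rescaled \<open>z\<close> represents
  \<open>f\<close>.\<close>

lemma Riesz_representation:
  fixes f :: "'a::chilbert_space \<Rightarrow> complex"
  assumes add: "\<And>x y. f (x + y) = f x + f y" and scale: "\<And>c x. f (c *\<^sub>C x) = c * f x"
    and bd: "\<And>x. cmod (f x) \<le> K * norm x"
  shows "\<exists>v. \<forall>x. f x = cinner v x"
proof (cases "\<forall>x. f x = 0")
  case True
  then show ?thesis by (intro exI[of _ 0]) simp
next
  case False
  then obtain x0 where x0: "f x0 \<noteq> 0" by blast
  define M where "M = {x. f x = 0}"
  have "bounded_linear f"
    by (rule bounded_linear_intro[where K=K])
      (use bd in \<open>simp_all add: add scale scaleR_scaleC scaleR_conv_of_real mult.commute\<close>)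
  then have M: "complex_vector.subspace M" "closed M"
    using closed_complex_subspaceI[of M f] add scale by (auto simp: M_def)
  have diff: "f (x - y) = f x - f y" for x y
    using add[of "x - y" y] by simp
  obtain m where m: "m \<in> M" "\<And>y. y \<in> M \<Longrightarrow> cinner y (x0 - m) = 0"
    using ex_orthogonal_projection[OF M, of x0] by blast
  define z where "z = x0 - m"
  have fz: "f z \<noteq> 0" using x0 m(1) by (simp add: z_def diff M_def)
  then have "z \<noteq> 0" using diff[of 0 0] by auto
  have "f x = cinner ((cnj (f z) / of_real ((norm z)\<^sup>2)) *\<^sub>C z) x" for x
  proof -
    have "x - (f x / f z) *\<^sub>C z \<in> M" using fz by (simp add: M_def diff scale)
    then have "cinner (x - (f x / f z) *\<^sub>C z) z = 0" using m(2) by (simp add: z_def)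
    then have "cinner z (x - (f x / f z) *\<^sub>C z) = 0" using cinner_commute by (metis complex_cnj_zero)
    then have "cinner z x = (f x / f z) * of_real ((norm z)\<^sup>2)"
      by (simp add: cinner_diff_right cinner_self)
    then show ?thesis using fz \<open>z \<noteq> 0\<close> by simp
  qed
  then show ?thesis by blast
qed

text \<open>Riesz supplies existence and nondegeneracy supplies uniqueness, so the
  \<open>THE\<close> in \<open>adj\<close> denotes.\<close>

lemma cinner_adj:
  fixes A :: "'a::chilbert_space \<Rightarrow> 'b::chilbert_space"
  assumes "bounded_clinear A"
  shows "cinner (adj A x) y = cinner x (A y)"
proof -
  obtain K where K: "\<And>y. norm (A y) \<le> K * norm y" using bounded_clinear_bound[OF assms] by blast
  have "\<exists>v. \<forall>y. cinner x (A y) = cinner v y" for x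
  proof (rule Riesz_representation[where K="norm x * K"])
    show "cmod (cinner x (A y)) \<le> norm x * K * norm y" for y
      using cinner_Cauchy_Schwarz[of x "A y"] mult_left_mono[OF K[of y], of "norm x"]
      by (simp add: mult.assoc)
  qed (simp_all add: assms bounded_clinear_add bounded_clinear_scaleC cinner_simps)
  then obtain B where B: "\<And>x y. cinner (B x) y = cinner x (A y)" by metis
  have "\<exists>!B. \<forall>x y. cinner (B x) y = cinner x (A y)"
  proof (rule ex1I[of _ B])
    fix C assume "\<forall>x y. cinner (C x) y = cinner x (A y)"
    then show "C = B" by (intro ext cinner_ext_left) (simp add: B)
  qed (simp add: B)
  from theI'[OF this] show ?thesis unfolding adj_def by blast
qed

lemma cinner_adj_right:
  "bounded_clinear A \<Longrightarrow> cinner x (adj A y) = cinner (A x) y"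
  by (metis cinner_adj cinner_commute)

lemma adj_eqI:
  assumes "\<And>x y. cinner (B x) y = cinner x (A y)" and "bounded_clinear A"
  shows "adj A = B"
  by (intro ext cinner_ext_left) (simp add: assms cinner_adj)

lemma bounded_clinear_adj:
  assumes "bounded_clinear A"
  shows "bounded_clinear (adj A)"
proof -
  obtain K where K: "K > 0" "\<And>y. norm (A y) \<le> K * norm y" using bounded_clinear_bound[OF assms] by blast
  have "norm (adj A x) \<le> K * norm x" for x
  proof (cases "adj A x = 0")
    case False
    have "(norm (adj A x))\<^sup>2 = cmod (cinner (adj A x) (adj A x))" by (simp add: cinner_self norm_power)
    also have "\<dots> \<le> norm x * norm (A (adj A x))"
      by (simp add: cinner_adj[OF assms] cinner_Cauchy_Schwarz)
    also have "\<dots> \<le> norm x * (K * norm (adj A x))" by (intro mult_left_mono K) simp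
    finally show ?thesis using False by (simp add: power2_eq_square mult_ac)
  qed (use K in simp)
  then show ?thesis
    by (intro bounded_clinearI[where K=K] cinner_ext_left)
      (simp_all add: cinner_adj[OF assms] cinner_simps)
qed

section \<open>Orthonormal systems and the existence of bases\<close>

definition orthonormal :: "'a::chilbert_space set \<Rightarrow> bool"
  where "orthonormal E \<longleftrightarrow> (\<forall>e\<in>E. \<forall>f\<in>E. cinner e f = (if e = f then 1 else 0))"

lemma orthonormalD: "orthonormal E \<Longrightarrow> e \<in> E \<Longrightarrow> f \<in> E \<Longrightarrow> cinner e f = (if e = f then 1 else 0)"
  by (simp add: orthonormal_def)

lemma orthonormal_subset: "orthonormal E \<Longrightarrow> F \<subseteq> E \<Longrightarrow> orthonormal F"
  unfolding orthonormal_def by (meson subsetD)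

lemma is_onb_iff: "is_onb B \<longleftrightarrow> orthonormal B \<and> closure (complex_vector.span B) = UNIV"
  by (simp add: is_onb_def orthonormal_def)

lemma subspace_closure:
  assumes "complex_vector.subspace (M :: 'a::chilbert_space set)"
  shows "complex_vector.subspace (closure M)"
proof -
  have "continuous_on UNIV (\<lambda>x::'a. c *\<^sub>C x)" for c
    by (intro linear_continuous_on bounded_clinear_bounded_linear bounded_clinear_scale bounded_clinear_id)
  then have scale: "(\<lambda>n. c *\<^sub>C s n) \<longlonglongrightarrow> c *\<^sub>C l" if "s \<longlonglongrightarrow> l" for c s and l :: 'a
    using that by (auto intro: continuous_on_tendsto_compose[where s=UNIV])
  have add: "x + y \<in> closure M" if "x \<in> closure M" "y \<in> closure M" for x y
  proof -
    obtain s t where "\<And>n. s n \<in> M" "s \<longlonglongrightarrow> x" "\<And>n. t n \<in> M" "t \<longlonglongrightarrow> y"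
      using \<open>x \<in> closure M\<close> \<open>y \<in> closure M\<close> unfolding closure_sequential by metis
    then show ?thesis
      unfolding closure_sequential
      by (intro exI[of _ "\<lambda>n. s n + t n"]) (simp add: tendsto_add complex_vector.subspace_add[OF assms])
  qed
  have "c *\<^sub>C x \<in> closure M" if "x \<in> closure M" for c x
  proof -
    obtain s where "\<And>n. s n \<in> M" "s \<longlonglongrightarrow> x"
      using \<open>x \<in> closure M\<close> unfolding closure_sequential by metis
    then show ?thesis
      unfolding closure_sequential
      by (intro exI[of _ "\<lambda>n. c *\<^sub>C s n"]) (simp add: scale complex_vector.subspace_scale[OF assms])
  qed
  with add show ?thesis
    using closure_subset[of M] complex_vector.subspace_0[OF assms]
    by (auto simp: complex_vector.subspace_def)
qed

text \<open>The residual of the projection onto the closed span is orthogonal to \<open>B\<close>,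
  hence zero.\<close>

lemma is_onbI:
  assumes "orthonormal B" and total: "\<And>x. (\<And>b. b \<in> B \<Longrightarrow> cinner b x = 0) \<Longrightarrow> x = 0"
  shows "is_onb B"
proof -
  have "x \<in> closure (complex_vector.span B)" for x
  proof -
    obtain m where m: "m \<in> closure (complex_vector.span B)"
      "\<And>y. y \<in> closure (complex_vector.span B) \<Longrightarrow> cinner y (x - m) = 0"
      using ex_orthogonal_projection[OF subspace_closure closed_closure, of "complex_vector.span B" x]
        complex_vector.subspace_span by blast
    have "x - m = 0"
    proof (rule total)
      fix b assume "b \<in> B"
      then show "cinner b (x - m) = 0"
        by (intro m(2) closure_subset[THEN subsetD] complex_vector.span_base)
    qed
    with m(1) show ?thesis by simp
  qed
  with assms(1) show ?thesis by (auto simp: is_onb_iff)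
qed

lemma orthogonal_closure_span:
  assumes "\<And>b. b \<in> B \<Longrightarrow> cinner b x = 0" and "y \<in> closure (complex_vector.span B)"
  shows "cinner y x = 0"
proof -
  define M where "M = {y. cinner x y = 0}"
  have "complex_vector.subspace M \<and> closed M"
    by (rule closed_complex_subspaceI[of _ "cinner x"])
      (simp_all add: M_def cinner_simps bounded_bilinear.bounded_linear_right[OF bounded_bilinear_cinner])
  moreover have "B \<subseteq> M" using assms(1) by (auto simp: M_def) (metis cinner_commute complex_cnj_zero)
  ultimately have "closure (complex_vector.span B) \<subseteq> M"
    by (intro closure_minimal complex_vector.span_minimal) auto
  with assms(2) have "cinner x y = 0" by (auto simp: M_def)
  then show ?thesis by (metis cinner_commute complex_cnj_zero)
qed

lemma dense_span_total:
  assumes "closure (complex_vector.span B) = UNIV" and "\<And>b. b \<in> B \<Longrightarrow> cinner b x = 0"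
  shows "x = 0"
  using orthogonal_closure_span[of B x x] assms by simp

lemma is_onb_total: "is_onb B \<Longrightarrow> (\<And>b. b \<in> B \<Longrightarrow> cinner b x = 0) \<Longrightarrow> x = 0"
  using dense_span_total is_onb_iff by blast

text \<open>A maximal orthonormal system, from Zorn's lemma, is total: a nonzero vector orthogonal
  to it could be normalized and added. This makes the choice in \<open>some_onb\<close>
  meaningful.\<close>

lemma ex_onb: "\<exists>B :: 'a::chilbert_space set. is_onb B"
proof -
  have "\<exists>M\<in>{B :: 'a set. orthonormal B}. \<forall>X\<in>{B. orthonormal B}. M \<subseteq> X \<longrightarrow> X = M"
  proof (rule subset_Zorn')
    fix C :: "'a set set" assume C: "subset.chain {B. orthonormal B} C"
    have "cinner e f = (if e = f then 1 else 0)" if "e \<in> \<Union>C" "f \<in> \<Union>C" for e f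
    proof -
      obtain X Y where XY: "X \<in> C" "Y \<in> C" "e \<in> X" "f \<in> Y"
        using \<open>e \<in> \<Union>C\<close> \<open>f \<in> \<Union>C\<close> by blast
      then have "orthonormal X" "orthonormal Y" "X \<subseteq> Y \<or> Y \<subseteq> X"
        using C by (auto simp: subset_chain_def)
      then show ?thesis using XY by (metis orthonormalD subsetD)
    qed
    then show "\<Union>C \<in> {B. orthonormal B}" by (simp add: orthonormal_def)
  qed
  then obtain M :: "'a set" where M: "orthonormal M" "\<And>X. orthonormal X \<Longrightarrow> M \<subseteq> X \<Longrightarrow> X = M" by blast
  have "is_onb M"
  proof (rule is_onbI[OF M(1)], rule ccontr)
    fix x assume x: "\<And>b. b \<in> M \<Longrightarrow> cinner b x = 0" "x \<noteq> 0"
    define u where "u = (1 / of_real (norm x)) *\<^sub>C x"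
    have "cinner u u = 1" using x(2) by (simp add: u_def cinner_self power2_eq_square norm_divide)
    moreover have "cinner b u = 0 \<and> cinner u b = 0" if "b \<in> M" for b
      using x(1)[OF that] cinner_commute[of x b] by (simp add: u_def)
    ultimately have "orthonormal (insert u M)" "u \<notin> M"
      using M(1) by (auto simp: orthonormal_def)
    then show False using M(2)[of "insert u M"] by blast
  qed
  then show ?thesis by blast
qed

lemma is_onb_some_onb: "is_onb some_onb"
  unfolding some_onb_def using ex_onb by (rule someI_ex)

lemma orthonormal_some_onb: "orthonormal some_onb"
  using is_onb_some_onb is_onb_iff by blast

subsection \<open>Finite orthonormal systems\<close>

text \<open>For finite orthonormal \<open>G\<close> this is the orthogonal projection onto the span
  of \<open>G\<close>.\<close>

definition proj_on :: "'a::chilbert_space set \<Rightarrow> 'a \<Rightarrow> 'a"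
  where "proj_on G x = (\<Sum>e\<in>G. cinner e x *\<^sub>C e)"

lemma cinner_proj_on:
  assumes "finite G" "orthonormal G" "e \<in> G"
  shows "cinner e (proj_on G x) = cinner e x"
proof -
  have "cinner e (proj_on G x) = (\<Sum>f\<in>G. if e = f then cinner f x else 0)"
    unfolding proj_on_def cinner_sum_right
    by (intro sum.cong) (simp_all add: orthonormalD[OF assms(2,3)])
  also have "\<dots> = cinner e x" using assms by simp
  finally show ?thesis .
qed

lemma cinner_proj_on_swap: "cinner x (proj_on G y) = cinner (proj_on G x) y"
  unfolding proj_on_def cinner_sum_right cinner_sum_left
  by (intro sum.cong) (simp_all add: cinner_commute[of x])

lemma norm_proj_on:
  assumes "finite G" "orthonormal G"
  shows "(norm (proj_on G x))\<^sup>2 = (\<Sum>e\<in>G. (cmod (cinner e x))\<^sup>2)"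
proof -
  have "cinner (proj_on G x) (proj_on G x) = (\<Sum>e\<in>G. cnj (cinner e x) * cinner e x)"
    unfolding proj_on_def[of G x] cinner_sum_left
    by (intro sum.cong) (simp_all add: cinner_proj_on[OF assms] flip: proj_on_def)
  also have "\<dots> = of_real (\<Sum>e\<in>G. (cmod (cinner e x))\<^sup>2)"
    by (simp only: of_real_sum complex_norm_square mult.commute)
  finally show ?thesis unfolding cinner_self of_real_eq_iff .
qed

lemma proj_on_in_span: "proj_on G x \<in> complex_vector.span G"
  unfolding proj_on_def
  by (intro complex_vector.span_sum complex_vector.span_scale complex_vector.span_base)

lemma proj_on_orthogonal:
  assumes "finite G" "orthonormal G" "y \<in> complex_vector.span G"
  shows "cinner y (x - proj_on G x) = 0"
  by (rule orthogonal_closure_span[of G])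
    (use assms closure_subset in \<open>auto simp: cinner_diff_right cinner_proj_on\<close>)

lemma proj_on_best:
  assumes "finite G" "orthonormal G" "y \<in> complex_vector.span G"
  shows "norm (x - proj_on G x) \<le> norm (x - y)"
proof (rule power2_le_imp_le)
  have "proj_on G x - y \<in> complex_vector.span G"
    by (intro complex_vector.span_diff assms proj_on_in_span)
  then have "cinner (proj_on G x - y) (x - proj_on G x) = 0" by (rule proj_on_orthogonal[OF assms(1,2)])
  with norm_add_square[of "proj_on G x - y" "x - proj_on G x"]
  show "(norm (x - proj_on G x))\<^sup>2 \<le> (norm (x - y))\<^sup>2" by simp
qed simp

lemma Bessel_inequality:
  assumes "finite G" "orthonormal G"
  shows "(\<Sum>e\<in>G. (cmod (cinner e x))\<^sup>2) \<le> (norm x)\<^sup>2"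
  using norm_add_square[of "proj_on G x" "x - proj_on G x"] norm_proj_on[OF assms, of x]
    proj_on_orthogonal[OF assms proj_on_in_span, of x x] by simp

text \<open>By density some vector in the span of a finite \<open>G\<close> is close to
  \<open>x\<close>; by best approximation the projection for every larger \<open>H\<close> is at
  least as close.\<close>

lemma proj_on_tendsto:
  assumes "is_onb E"
  shows "((\<lambda>G. proj_on G x) \<longlongrightarrow> x) (finite_subsets_at_top E)"
proof (rule tendstoI)
  fix \<epsilon> :: real assume "\<epsilon> > 0"
  have "x \<in> closure (complex_vector.span E)" using assms by (simp add: is_onb_iff)
  then obtain y where y: "y \<in> complex_vector.span E" "dist y x < \<epsilon>"
    using \<open>\<epsilon> > 0\<close> by (auto simp: closure_approachable)
  obtain G r where G: "finite G" "G \<subseteq> E" "y = (\<Sum>a\<in>G. r a *\<^sub>C a)"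
    using y(1) by (auto simp: complex_vector.span_explicit)
  show "\<forall>\<^sub>F H in finite_subsets_at_top E. dist (proj_on H x) x < \<epsilon>"
    unfolding eventually_finite_subsets_at_top
  proof (intro exI[of _ G] conjI allI impI)
    fix H assume H: "finite H \<and> G \<subseteq> H \<and> H \<subseteq> E"
    then have "y \<in> complex_vector.span H" unfolding G(3)
      by (intro complex_vector.span_sum complex_vector.span_scale complex_vector.span_base) auto
    with H have "norm (x - proj_on H x) \<le> norm (x - y)"
      using assms by (intro proj_on_best) (auto simp: is_onb_iff intro: orthonormal_subset)
    then show "dist (proj_on H x) x < \<epsilon>" using y(2) by (simp add: dist_norm norm_minus_commute)
  qed (use G in auto)
qed

lemma finite_onb_expansion:
  assumes "is_onb E" "finite E"
  shows "(\<Sum>e\<in>E. cinner e x *\<^sub>C e) = x"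
  \<comment> \<open>For finite \<open>E\<close> the filter is concentrated on the single set
    \<open>E\<close>, so the limit is the value there.\<close>
  using proj_on_tendsto[OF assms(1), of x] assms(2)
  by (simp add: finite_subsets_at_top_finite tendsto_principal_singleton proj_on_def[symmetric])
    (metis (lifting) LIM_const_eq proj_on_tendsto tendsto_principal_singleton tendsto_unique principal_eq_bot_iff insert_not_empty)


subsection \<open>Traces of positive operators\<close>

lemma bounded_clinear_rank_one: "bounded_clinear (\<lambda>x. cinner v x *\<^sub>C w)"
proof (rule bounded_clinearI[where K="norm v * norm w"])
  show "norm (cinner v x *\<^sub>C w) \<le> norm v * norm w * norm x" for x
    using mult_right_mono[OF cinner_Cauchy_Schwarz[of v x], of "norm w"] by (simp add: mult_ac)
qed (simp_all add: cinner_simps scaleC_add_left scaleC_scaleC)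

text \<open>Cholesky elimination. Subtracting \<open>|S g><S g| / <g, S g>\<close> leaves a positive
  operator by Cauchy-Schwarz and kills \<open>g\<close>; vectors killed earlier stay killed because
  \<open><S g, h> = <g, S h> = 0\<close>.\<close>

lemma positive_op_deflate:
  assumes "positive_op T" "finite G"
  shows "\<exists>S w. positive_op S \<and> (\<forall>g\<in>G. S g = 0) \<and> (\<forall>x. T x = S x + (\<Sum>g\<in>G. cinner (w g) x *\<^sub>C w g))"
  using assms(2)
proof (induction G rule: finite_induct)
  case empty
  then show ?case using assms(1) by (intro exI[of _ T]) simp
next
  case (insert g G)
  then obtain S w where S: "positive_op S" "\<And>h. h \<in> G \<Longrightarrow> S h = 0"
    and T: "\<And>x. T x = S x + (\<Sum>g\<in>G. cinner (w g) x *\<^sub>C w g)" by blast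
  note sym = positive_op_symmetric[OF S(1)] and bcl = positive_op_bounded_clinear[OF S(1)]
  \<comment> \<open>If \<open>c = 0\<close>, then division by zero makes \<open>v = 0\<close> and
    nothing is subtracted; Cauchy-Schwarz shows that \<open>S g\<close> is already 0 in this
    case.\<close>
  define c v where "c = Re (cinner g (S g))" and "v = of_real (1 / sqrt c) *\<^sub>C S g"
  define S' where "S' x = S x - cinner v x *\<^sub>C v" for x
  have "c \<ge> 0" unfolding c_def by (rule positive_op_Re[OF S(1)])
  have Sg: "cinner g (S g) = of_real c" unfolding c_def by (rule positive_op_cinner[OF S(1)])
  have vv: "cinner x v * cinner v y = cinner x (S g) * cinner (S g) y / of_real c" for x y
    using \<open>c \<ge> 0\<close> by (simp add: v_def flip: of_real_mult)
  have cxx: "cinner x (S' x) = of_real (Re (cinner x (S x)) - (cmod (cinner x (S g)))\<^sup>2 / c)" for x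
  proof -
    have "cinner x (S' x) = cinner x (S x) - cinner x v * cinner v x"
      by (simp add: S'_def cinner_diff_right mult.commute)
    also have "cinner x v * cinner v x = of_real ((cmod (cinner x (S g)))\<^sup>2) / of_real c"
      unfolding vv complex_norm_square cinner_commute[of "S g" x] ..
    finally show ?thesis by (subst (asm) positive_op_cinner[OF S(1)]) simp
  qed
  have "positive_op S'"
    unfolding positive_op_iff
  proof (intro conjI allI)
    show "bounded_clinear S'"
      unfolding S'_def by (intro bounded_clinear_minus bounded_clinear_rank_one bcl)
    fix x
    show "Im (cinner x (S' x)) = 0" by (simp add: cxx)
    have CS: "(cmod (cinner x (S g)))\<^sup>2 \<le> Re (cinner x (S x)) * c"
      unfolding c_def by (rule positive_op_Cauchy_Schwarz[OF S(1)])
    have "(cmod (cinner x (S g)))\<^sup>2 / c \<le> Re (cinner x (S x))"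
    proof (cases "c = 0")
      case True
      then show ?thesis using positive_op_Re[OF S(1), of x] by simp
    next
      case False
      then show ?thesis using CS \<open>c \<ge> 0\<close> by (simp add: field_simps)
    qed
    then show "0 \<le> Re (cinner x (S' x))" by (simp add: cxx)
  qed
  moreover have "S' h = 0" if "h \<in> insert g G" for h
  proof (cases "h = g")
    case False
    with that have "S h = 0" using S(2) by simp
    then have "cinner v h = 0" by (simp add: v_def sym)
    with \<open>S h = 0\<close> show ?thesis by (simp add: S'_def)
  next
    case True
    have "cinner x (S' g) = 0" for x
    proof -
      have "cinner x (S' g) = cinner x (S g) - cinner x v * cinner v g"
        by (simp add: S'_def cinner_diff_right mult.commute)
      also have "\<dots> = cinner x (S g) - cinner x (S g) * of_real c / of_real c"
        by (simp add: vv sym Sg)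
      also have "\<dots> = 0"
        using positive_op_Cauchy_Schwarz[OF S(1), of x g] by (cases "c = 0") (simp_all flip: c_def)
      finally show ?thesis .
    qed
    with True show ?thesis by (intro cinner_ext) simp
  qed
  moreover have "T x = S' x + (\<Sum>h\<in>insert g G. cinner ((w(g := v)) h) x *\<^sub>C (w(g := v)) h)" for x
  proof -
    have "(\<Sum>h\<in>G. cinner ((w(g := v)) h) x *\<^sub>C (w(g := v)) h) = (\<Sum>h\<in>G. cinner (w h) x *\<^sub>C w h)"
      using insert.hyps by (intro sum.cong) auto
    then show ?thesis using insert.hyps by (simp add: T S'_def)
  qed
  ultimately show ?case by blast
qed

text \<open>With \<open>p\<close> the projection onto the span of \<open>G\<close>, this compares
  the diagonal of \<open>p T p\<close> over \<open>F\<close> with its trace. On that span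
  \<open>T\<close> is the Gram sum of the \<open>w g\<close>, so after exchanging the sums Bessel
  over \<open>F\<close> bounds each term by the squared norm of \<open>p (w g)\<close>, which
  expands over \<open>G\<close>.\<close>

lemma positive_op_compressed_sum_le:
  assumes T: "positive_op T" and F: "finite F" "orthonormal F" and G: "finite G" "orthonormal G"
  shows "(\<Sum>f\<in>F. Re (cinner (proj_on G f) (T (proj_on G f)))) \<le> (\<Sum>g\<in>G. Re (cinner g (T g)))"
proof -
  obtain S w where S: "positive_op S" "\<And>g. g \<in> G \<Longrightarrow> S g = 0"
    and T: "\<And>x. T x = S x + (\<Sum>g\<in>G. cinner (w g) x *\<^sub>C w g)"
    using positive_op_deflate[OF T G(1)] by blast
  note bcl = positive_op_bounded_clinear[OF S(1)]
  have quad: "Re (cinner y (T y)) = (\<Sum>g\<in>G. (cmod (cinner (w g) y))\<^sup>2)" if "S y = 0" for y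
  proof -
    have "cinner y (T y) = (\<Sum>g\<in>G. cinner (w g) y * cnj (cinner (w g) y))"
      unfolding T that cinner_simps cinner_sum_right by (simp add: cinner_commute[of y])
    also have "\<dots> = of_real (\<Sum>g\<in>G. (cmod (cinner (w g) y))\<^sup>2)"
      by (simp only: of_real_sum complex_norm_square)
    finally show ?thesis by (simp del: of_real_sum of_real_power)
  qed
  have "S (proj_on G f) = 0" for f
    by (simp add: proj_on_def bounded_clinear_sum[OF bcl] bounded_clinear_scaleC[OF bcl] S(2))
  moreover have "cmod (cinner w (proj_on G f)) = cmod (cinner f (proj_on G w))" for w f
    unfolding cinner_proj_on_swap[of w] by (rule norm_cinner_commute)
  ultimately have "(\<Sum>f\<in>F. Re (cinner (proj_on G f) (T (proj_on G f))))
      = (\<Sum>f\<in>F. \<Sum>g\<in>G. (cmod (cinner f (proj_on G (w g))))\<^sup>2)"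
    by (simp add: quad)
  also have "\<dots> = (\<Sum>g\<in>G. \<Sum>f\<in>F. (cmod (cinner f (proj_on G (w g))))\<^sup>2)" by (rule sum.swap)
  also have "\<dots> \<le> (\<Sum>g\<in>G. (norm (proj_on G (w g)))\<^sup>2)"
    by (intro sum_mono Bessel_inequality F)
  also have "\<dots> = (\<Sum>g\<in>G. \<Sum>h\<in>G. (cmod (cinner h (w g)))\<^sup>2)" by (simp add: norm_proj_on[OF G])
  also have "\<dots> = (\<Sum>h\<in>G. \<Sum>g\<in>G. (cmod (cinner h (w g)))\<^sup>2)" by (rule sum.swap)
  also have "\<dots> = (\<Sum>h\<in>G. Re (cinner h (T h)))"
    by (intro sum.cong refl) (simp add: quad S(2) norm_cinner_commute)
  finally show ?thesis .
qed

text \<open>The bound for compressions is uniform in \<open>G\<close>, and for a fixed finite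
  \<open>F\<close> the compressed sums converge as \<open>G\<close> exhausts
  \<open>E\<close>.\<close>

lemma positive_op_finite_sum_le:
  assumes T: "positive_op T" and F: "finite F" "orthonormal F" and E: "is_onb E"
    and summ: "(\<lambda>e. Re (cinner e (T e))) summable_on E"
  shows "(\<Sum>f\<in>F. Re (cinner f (T f))) \<le> (\<Sum>\<^sub>\<infinity>e\<in>E. Re (cinner e (T e)))"
proof (rule tendsto_upperbound)
  have "((\<lambda>G. Re (cinner (proj_on G f) (T (proj_on G f)))) \<longlongrightarrow> Re (cinner f (T f))) (finite_subsets_at_top E)" for f
    by (intro tendsto_Re bounded_bilinear.tendsto[OF bounded_bilinear_cinner] proj_on_tendsto E
        bounded_linear.tendsto[OF bounded_clinear_bounded_linear[OF positive_op_bounded_clinear[OF T]]])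
  then show "((\<lambda>G. \<Sum>f\<in>F. Re (cinner (proj_on G f) (T (proj_on G f)))) \<longlongrightarrow> (\<Sum>f\<in>F. Re (cinner f (T f))))
      (finite_subsets_at_top E)" by (intro tendsto_sum)
  show "\<forall>\<^sub>F G in finite_subsets_at_top E. (\<Sum>f\<in>F. Re (cinner (proj_on G f) (T (proj_on G f))))
      \<le> (\<Sum>\<^sub>\<infinity>e\<in>E. Re (cinner e (T e)))"
  proof (rule eventually_finite_subsets_at_top_weakI)
    fix G assume G: "finite G" "G \<subseteq> E"
    have "orthonormal G" using E G orthonormal_subset is_onb_iff by blast
    then have "(\<Sum>f\<in>F. Re (cinner (proj_on G f) (T (proj_on G f)))) \<le> (\<Sum>g\<in>G. Re (cinner g (T g)))"
      by (intro positive_op_compressed_sum_le T F G)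
    also have "\<dots> \<le> (\<Sum>\<^sub>\<infinity>e\<in>E. Re (cinner e (T e)))"
      by (intro finite_sum_le_infsum summ G positive_op_Re[OF T])
    finally show "(\<Sum>f\<in>F. Re (cinner (proj_on G f) (T (proj_on G f)))) \<le> (\<Sum>\<^sub>\<infinity>e\<in>E. Re (cinner e (T e)))" .
  qed
qed simp

lemma positive_op_summable_orthonormal:
  assumes T: "positive_op T" and F: "orthonormal F" and E: "is_onb E"
    and summ: "(\<lambda>e. Re (cinner e (T e))) summable_on E"
  shows "(\<lambda>f. Re (cinner f (T f))) summable_on F"
proof (rule nonneg_bdd_above_summable_on)
  show "bdd_above (sum (\<lambda>f. Re (cinner f (T f))) ` {A. A \<subseteq> F \<and> finite A})"
    using positive_op_finite_sum_le[OF T _ orthonormal_subset[OF F] E summ] by (intro bdd_aboveI2) blast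
qed (rule positive_op_Re[OF T])

lemma positive_op_infsum_le:
  assumes T: "positive_op T" and F: "orthonormal F" and E: "is_onb E"
    and summ: "(\<lambda>e. Re (cinner e (T e))) summable_on E"
  shows "(\<Sum>\<^sub>\<infinity>f\<in>F. Re (cinner f (T f))) \<le> (\<Sum>\<^sub>\<infinity>e\<in>E. Re (cinner e (T e)))"
  using positive_op_finite_sum_le[OF T _ orthonormal_subset[OF F] E summ]
  by (intro infsum_le_finite_sums positive_op_summable_orthonormal[OF assms])

text \<open>Traces are complex sums, while comparison and monotonicity arguments need real ones;
  this passes between the two.\<close>

lemma positive_op_summable_complex_iff:
  assumes "positive_op T"
  shows "(\<lambda>e. cinner e (T e)) summable_on E \<longleftrightarrow> (\<lambda>e. Re (cinner e (T e))) summable_on E"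
proof
  assume "(\<lambda>e. cinner e (T e)) summable_on E"
  then show "(\<lambda>e. Re (cinner e (T e))) summable_on E"
    by (rule summable_on_bounded_linear[OF bounded_linear_Re, unfolded o_def])
next
  assume "(\<lambda>e. Re (cinner e (T e))) summable_on E"
  then have "(\<lambda>e. complex_of_real (Re (cinner e (T e)))) summable_on E"
    by (rule summable_on_bounded_linear[OF bounded_linear_of_real, unfolded o_def])
  then show "(\<lambda>e. cinner e (T e)) summable_on E" by (simp flip: positive_op_cinner[OF assms])
qed

lemma positive_op_infsum_complex:
  assumes "positive_op T"
  shows "(\<Sum>\<^sub>\<infinity>e\<in>E. cinner e (T e)) = of_real (\<Sum>\<^sub>\<infinity>e\<in>E. Re (cinner e (T e)))"
proof -
  have "(\<lambda>e. complex_of_real (Re (cinner e (T e)))) summable_on E \<longleftrightarrow> (\<lambda>e. Re (cinner e (T e))) summable_on E"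
    by (simp add: positive_op_summable_complex_iff[OF assms] flip: positive_op_cinner[OF assms])
  from infsum_bounded_linear_strong[OF this bounded_linear_of_real] show ?thesis
    by (simp flip: positive_op_cinner[OF assms])
qed

text \<open>The one-sided bound is used in both directions; finite trace in \<open>E\<close> first
  yields summability in \<open>F\<close>, which is what allows the roles to be exchanged.\<close>

lemma positive_op_trace_onb:
  assumes T: "positive_op T" and EF: "is_onb E" "is_onb F"
    and summ: "(\<lambda>e. cinner e (T e)) summable_on E"
  shows "(\<Sum>\<^sub>\<infinity>f\<in>F. cinner f (T f)) = (\<Sum>\<^sub>\<infinity>e\<in>E. cinner e (T e))"
proof -
  have on: "orthonormal E" "orthonormal F" using EF is_onb_iff by blast+
  have summE: "(\<lambda>e. Re (cinner e (T e))) summable_on E"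
    using summ by (simp add: positive_op_summable_complex_iff[OF T])
  have summF: "(\<lambda>e. Re (cinner e (T e))) summable_on F"
    by (rule positive_op_summable_orthonormal[OF T on(2) EF(1) summE])
  show ?thesis
    unfolding positive_op_infsum_complex[OF T]
    using positive_op_infsum_le[OF T on(2) EF(1) summE] positive_op_infsum_le[OF T on(1) EF(2) summF]
    by simp
qed

text \<open>Otherwise let \<open>m < 0\<close> be the bottom of the numerical range of \<open>P - A\<close>. Unit vectors \<open>x\<close>
  with \<open>\<langle>x, (P - A) x\<rangle>\<close> near \<open>m\<close> are approximate eigenvectors, so \<open>A x\<close> is near \<open>(P - m) x\<close>; but
  \<open>\<parallel>(P - m) x\<parallel>\<^sup>2 \<ge> \<parallel>P x\<parallel>\<^sup>2 + m\<^sup>2\<close>, while \<open>\<parallel>A x\<parallel> = \<parallel>P x\<parallel>\<close>.\<close>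

lemma symmetric_le_modulus:
  assumes P: "positive_op P" and A: "bounded_clinear A"
    and sym: "\<And>x y. cinner (A x) y = cinner x (A y)" and sq: "\<And>x. P (P x) = A (A x)"
  shows "positive_op (\<lambda>x. P x - A x)"
proof -
  note Pb = positive_op_bounded_clinear[OF P]
  define D where "D x = P x - A x" for x
  have Db: "bounded_clinear D" unfolding D_def by (intro bounded_clinear_minus Pb A)
  have Dsym: "cinner (D x) y = cinner x (D y)" for x y
    by (simp add: D_def cinner_simps sym positive_op_symmetric[OF P])
  have ImD: "Im (cinner x (D x)) = 0" for x
    using arg_cong[OF cinner_commute[of x "D x"], of Im] by (simp add: Dsym)
  obtain K where K: "K > 0" "\<And>x. norm (D x) \<le> K * norm x" using bounded_clinear_bound[OF Db] by blast
  obtain L where L: "L > 0" "\<And>x. norm (P x) \<le> L * norm x" using bounded_clinear_bound[OF Pb] by blast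
  have normPA: "norm (P x) = norm (A x)" for x
  proof -
    have "cinner (P x) (P x) = cinner (A x) (A x)"
      by (simp add: positive_op_symmetric[OF P] sym sq)
    then have "(norm (P x))\<^sup>2 = (norm (A x))\<^sup>2" unfolding cinner_self of_real_eq_iff .
    then show ?thesis by simp
  qed
  define N where "N = {Re (cinner x (D x)) |x. norm x = 1}"
  have "- K \<le> r" if "r \<in> N" for r
  proof -
    obtain x where x: "r = Re (cinner x (D x))" "norm x = 1" using \<open>r \<in> N\<close> by (auto simp: N_def)
    have "\<bar>r\<bar> \<le> norm x * norm (D x)"
      unfolding x(1) using abs_Re_le_cmod cinner_Cauchy_Schwarz order_trans by blast
    with K(2)[of x] x(2) show ?thesis by simp
  qed
  then have bdd: "bdd_below N" by (rule bdd_belowI)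
  have "0 \<le> Re (cinner x (D x))" for x
  proof (rule ccontr)
    assume neg: "\<not> 0 \<le> Re (cinner x (D x))"
    then have "x \<noteq> 0" by auto
    define m where "m = Inf N"
    have lower: "m * (norm y)\<^sup>2 \<le> Re (cinner y (D y))" for y
    proof (cases "y = 0")
      case False
      define u where "u = of_real (1 / norm y) *\<^sub>C y"
      have "norm u = 1" using False by (simp add: u_def norm_divide)
      then have "m \<le> Re (cinner u (D u))" unfolding m_def
        by (intro cInf_lower bdd) (use \<open>norm u = 1\<close> in \<open>unfold N_def, blast\<close>)
      also have "\<dots> = Re (cinner y (D y)) / (norm y)\<^sup>2"
        by (simp add: u_def bounded_clinear_scaleC[OF Db] power2_eq_square mult_ac)
      finally show ?thesis using False by (simp add: field_simps)
    qed simp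
    have "m * (norm x)\<^sup>2 < 0" using lower[of x] neg by linarith
    then have "m < 0" using \<open>x \<noteq> 0\<close> by (simp add: mult_less_0_iff)
    define D' where "D' x = D x - of_real m *\<^sub>C x" for x
    have D': "positive_op D'"
      unfolding positive_op_iff
    proof (intro conjI allI)
      show "bounded_clinear D'" unfolding D'_def
        by (intro bounded_clinear_minus Db bounded_clinear_scale bounded_clinear_id)
      fix x
      have "cinner x (D' x) = cinner x (D x) - of_real (m * (norm x)\<^sup>2)"
        by (simp add: D'_def cinner_diff_right cinner_self)
      then show "0 \<le> Re (cinner x (D' x))" "Im (cinner x (D' x)) = 0"
        using lower[of x] ImD[of x] by (simp_all del: of_real_mult of_real_power)
    qed
    obtain K' where K': "K' > 0" "\<And>x. norm (D' x) \<le> K' * norm x"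
      using bounded_clinear_bound[OF positive_op_bounded_clinear[OF D']] by blast
    \<comment> \<open>Cauchy-Schwarz for the form of \<open>D'\<close> at \<open>D' y\<close> and
      \<open>y\<close>. A small value of the quadratic form thus forces a small vector
      \<open>D' y\<close>, which makes \<open>y\<close> an approximate eigenvector.\<close>
    have D'_sq: "(norm (D' y))\<^sup>2 \<le> K' * Re (cinner y (D' y))" for y
    proof (cases "D' y = 0")
      case False
      have "((norm (D' y))\<^sup>2)\<^sup>2 = (cmod (cinner (D' y) (D' y)))\<^sup>2" by (simp add: cinner_self norm_power)
      also have "\<dots> \<le> Re (cinner (D' y) (D' (D' y))) * Re (cinner y (D' y))"
        by (rule positive_op_Cauchy_Schwarz[OF D'])
      also have "\<dots> \<le> (K' * (norm (D' y))\<^sup>2) * Re (cinner y (D' y))"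
      proof (rule mult_right_mono[OF _ positive_op_Re[OF D']])
        have "Re (cinner (D' y) (D' (D' y))) \<le> norm (D' y) * norm (D' (D' y))"
          using complex_Re_le_cmod cinner_Cauchy_Schwarz order_trans by blast
        also have "\<dots> \<le> norm (D' y) * (K' * norm (D' y))" by (intro mult_left_mono K') simp
        finally show "Re (cinner (D' y) (D' (D' y))) \<le> K' * (norm (D' y))\<^sup>2"
          by (simp add: power2_eq_square mult_ac)
      qed
      finally show ?thesis using False by (simp add: power2_eq_square mult_ac)
    qed (use K' positive_op_Re[OF D', of y] in simp)
    \<comment> \<open>The final estimate is
      \<open>m\<^sup>2 \<le> \<epsilon> * (2 * p + \<epsilon>)\<close> with
      \<open>p \<le> L\<close>; this choice keeps the right side at most half of
      \<open>m\<^sup>2\<close>.\<close>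
    define \<epsilon> where "\<epsilon> = min 1 (m\<^sup>2 / (2 * (2 * L + 1)))"
    have eps: "\<epsilon> > 0" "\<epsilon> \<le> 1" "\<epsilon> * (2 * L + 1) < m\<^sup>2"
    proof -
      show "\<epsilon> > 0" "\<epsilon> \<le> 1" using \<open>m < 0\<close> L(1) by (simp_all add: \<epsilon>_def)
      have "\<epsilon> * (2 * L + 1) \<le> m\<^sup>2 / (2 * (2 * L + 1)) * (2 * L + 1)"
        using L(1) by (intro mult_right_mono) (simp_all add: \<epsilon>_def)
      also have "\<dots> = m\<^sup>2 / 2" using L(1) by (simp add: field_simps)
      also have "\<dots> < m\<^sup>2" using \<open>m < 0\<close> by simp
      finally show "\<epsilon> * (2 * L + 1) < m\<^sup>2" .
    qed
    have "N \<noteq> {}"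
    proof -
      have "norm (of_real (1 / norm x) *\<^sub>C x) = 1" using \<open>x \<noteq> 0\<close> by (simp add: norm_divide)
      then show ?thesis unfolding N_def by blast
    qed
    \<comment> \<open>The margin \<open>\<epsilon>\<^sup>2 / K'\<close> is what \<open>D'_sq\<close>
      converts into \<open>norm (D' y) \<le> \<epsilon>\<close>.\<close>
    moreover have "Inf N < m + \<epsilon>\<^sup>2 / K'" using eps(1) K'(1) by (simp flip: m_def)
    ultimately have "\<exists>r\<in>N. r < m + \<epsilon>\<^sup>2 / K'"
      by (rule cInf_lessD)
    then obtain y where y: "norm y = 1" "Re (cinner y (D y)) < m + \<epsilon>\<^sup>2 / K'"
      unfolding N_def by blast
    have "Re (cinner y (D' y)) \<le> \<epsilon>\<^sup>2 / K'"
      using y by (simp add: D'_def cinner_simps cinner_self)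
    then have "K' * Re (cinner y (D' y)) \<le> \<epsilon>\<^sup>2" using K'(1) by (simp add: field_simps)
    then have "(norm (D' y))\<^sup>2 \<le> \<epsilon>\<^sup>2" using D'_sq[of y] by linarith
    then have r: "norm (D' y) \<le> \<epsilon>" by (rule power2_le_imp_le) (use eps(1) in simp)
    define p where "p = norm (P y)"
    have "p \<le> L" using L(2)[of y] y(1) by (simp add: p_def)
    have "p\<^sup>2 + m\<^sup>2 \<le> (norm (P y + of_real (- m) *\<^sub>C y))\<^sup>2"
    proof -
      have "Re (cinner (P y) (of_real (- m) *\<^sub>C y)) \<ge> 0"
        using positive_op_Re[OF P, of y] \<open>m < 0\<close> by (simp add: positive_op_symmetric[OF P] mult_nonpos_nonneg)
      then show ?thesis unfolding norm_add_square p_def using y(1) by simp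
    qed
    also have "\<dots> \<le> (p + \<epsilon>)\<^sup>2"
    proof (rule power_mono)
      have "P y + of_real (- m) *\<^sub>C y = A y + D' y" by (simp add: D'_def D_def)
      then show "norm (P y + of_real (- m) *\<^sub>C y) \<le> p + \<epsilon>"
        using norm_triangle_ineq[of "A y" "D' y"] r by (simp add: p_def normPA)
    qed simp
    finally have "p\<^sup>2 + m\<^sup>2 \<le> (p + \<epsilon>)\<^sup>2" .
    moreover have "(p + \<epsilon>)\<^sup>2 = p\<^sup>2 + \<epsilon> * (2 * p + \<epsilon>)" by (simp add: power2_eq_square algebra_simps)
    ultimately have "m\<^sup>2 \<le> \<epsilon> * (2 * p + \<epsilon>)" by linarith
    also have "\<dots> \<le> \<epsilon> * (2 * L + 1)" using \<open>p \<le> L\<close> eps by (intro mult_left_mono) auto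
    finally show False using eps(3) by simp
  qed
  then have "positive_op D" by (simp add: positive_op_iff Db ImD)
  then show ?thesis by (simp only: D_def[abs_def])
qed

subsection \<open>Nuclear operators\<close>

text \<open>Mathematically this is the trace class. In inductive form, a linear statement about
  traces follows by induction from the case of positive operators.\<close>

inductive nuclear :: "('a::chilbert_space \<Rightarrow> 'a) \<Rightarrow> bool"
  where pos: "positive_op T \<Longrightarrow> (\<lambda>e. cinner e (T e)) summable_on some_onb \<Longrightarrow> nuclear T"
  | add: "nuclear S \<Longrightarrow> nuclear T \<Longrightarrow> nuclear (\<lambda>x. S x + T x)"
  | scale: "nuclear T \<Longrightarrow> nuclear (\<lambda>x. c *\<^sub>C T x)"

lemma nuclear_bounded_clinear: "nuclear T \<Longrightarrow> bounded_clinear T"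
  by (induction rule: nuclear.induct)
    (simp_all add: positive_op_bounded_clinear bounded_clinear_plus bounded_clinear_scale)

text \<open>Finite trace may be checked in any convenient basis, such as a product basis.\<close>

lemma nuclear_positiveI:
  assumes T: "positive_op T" and E: "is_onb E" and "(\<lambda>e. cinner e (T e)) summable_on E"
  shows "nuclear T"
  using assms(3) positive_op_summable_orthonormal[OF T orthonormal_some_onb E]
  by (intro nuclear.pos T) (simp add: positive_op_summable_complex_iff[OF T])

lemma nuclear_minus: "nuclear S \<Longrightarrow> nuclear T \<Longrightarrow> nuclear (\<lambda>x. S x - T x)"
  using nuclear.add[OF _ nuclear.scale[of T "-1"], of S] by simp

lemma nuclear_zero: "nuclear (\<lambda>x. 0)"
  by (rule nuclear.pos) (simp_all add: positive_op_iff bounded_clinear_const_zero)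

lemma nuclear_sum: "(\<And>i. i \<in> I \<Longrightarrow> nuclear (F i)) \<Longrightarrow> nuclear (\<lambda>x. \<Sum>i\<in>I. F i x)"
  by (induction I rule: infinite_finite_induct) (simp_all add: nuclear_zero nuclear.add)

lemma nuclear_summable:
  assumes "nuclear T" "orthonormal F"
  shows "(\<lambda>f. cinner f (T f)) summable_on F"
  using assms(1)
proof (induction rule: nuclear.induct)
  case (pos T)
  then show ?case
    using positive_op_summable_orthonormal[OF pos(1) assms(2) is_onb_some_onb]
    by (simp add: positive_op_summable_complex_iff)
qed (simp_all add: cinner_simps summable_on_add summable_on_cmult_right)

lemma nuclear_trace:
  assumes "nuclear T" "is_onb F"
  shows "(\<Sum>\<^sub>\<infinity>f\<in>F. cinner f (T f)) = op_trace T"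
  using assms(1)
proof (induction rule: nuclear.induct)
  case (pos T)
  then show ?case unfolding op_trace_def by (intro positive_op_trace_onb assms(2) is_onb_some_onb)
next
  case (add S T)
  have on: "orthonormal F" using assms(2) is_onb_iff by blast
  show ?case
    using add.IH unfolding op_trace_def
    by (simp add: cinner_simps infsum_add nuclear_summable[OF add.hyps(1)] nuclear_summable[OF add.hyps(2)]
        on orthonormal_some_onb)
next
  case (scale T c)
  then show ?case unfolding op_trace_def by (simp add: infsum_cmult_right')
qed

text \<open>This holds for divergent traces too: scaling by a nonzero \<open>c\<close> preserves
  divergence, where both sides are 0, and \<open>c = 0\<close> is trivial.\<close>

lemma op_trace_scale: "op_trace (\<lambda>x. c *\<^sub>C T x) = c * op_trace T"
  unfolding op_trace_def by (simp add: infsum_cmult_right')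

text \<open>Meant for \<open>V = tens \<phi>\<close> and \<open>W = tens \<psi>\<close>: the matrix
  elements of a partial trace converge. Both maps are multiples of isometries, and for positive
  \<open>T\<close> an off-diagonal term is dominated by the sum of two diagonal ones.\<close>

lemma nuclear_matrix_summable:
  fixes V W :: "'e::chilbert_space \<Rightarrow> 'k::chilbert_space"
  assumes "nuclear T" and E: "orthonormal E"
    and V: "\<And>x y. cinner (V x) (V y) = a * cinner x y" and W: "\<And>x y. cinner (W x) (W y) = b * cinner x y"
  shows "(\<lambda>e. cinner (V e) (T (W e))) summable_on E"
  using assms(1)
proof (induction rule: nuclear.induct)
  case (pos T)
  note lin = bounded_clinear_scaleC[OF positive_op_bounded_clinear[OF pos(1)]]
  have diag: "(\<lambda>e. Re (cinner (Z e) (T (Z e)))) summable_on E"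
    if Z: "\<And>x y. cinner (Z x) (Z y) = c * cinner x y" for Z :: "'e \<Rightarrow> 'k" and c
  proof (cases "c = 0")
    case True
    then have "Z e = 0" for e using Z[of e e] by simp
    then show ?thesis by simp
  next
    case False
    have Zn: "complex_of_real ((norm (Z e))\<^sup>2) = c" if "e \<in> E" for e
      using Z[of e e] orthonormalD[OF E that that] by (simp add: cinner_self)
    define r where "r = sqrt (cmod c)"
    have r: "r > 0" using False by (simp add: r_def)
    \<comment> \<open>That \<open>c\<close> is a nonnegative real is visible only through some unit
      vector in \<open>E\<close>, hence the condition; for empty \<open>E\<close> there is nothing
      to sum.\<close>
    have rc: "complex_of_real (r * r) = c" if "e \<in> E" for e
    proof -
      have "cmod c = (norm (Z e))\<^sup>2" unfolding Zn[OF that, symmetric] norm_of_real by simp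
      then have "r * r = (norm (Z e))\<^sup>2" by (simp add: r_def flip: power2_eq_square)
      then show ?thesis by (simp only: Zn[OF that])
    qed
    define Y where "Y e = of_real (1 / r) *\<^sub>C Z e" for e
    have YY: "cinner (Y e) (Y f) = cinner e f" if "e \<in> E" for e f
      unfolding Y_def using r rc[OF that] False by (simp add: Z field_simps)
    then have inj: "inj_on Y E" unfolding inj_on_def
      using orthonormalD[OF E] by (metis one_neq_zero)
    have "orthonormal (Y ` E)"
      unfolding orthonormal_def using YY orthonormalD[OF E] inj by (auto simp: inj_on_eq_iff)
    then have "(\<lambda>f. cinner f (T f)) summable_on Y ` E"
      using nuclear_summable[OF nuclear.pos[OF pos]] by blast
    then have "(\<lambda>f. Re (cinner f (T f))) summable_on Y ` E"
      by (simp add: positive_op_summable_complex_iff[OF pos(1)])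
    then have "(\<lambda>e. r\<^sup>2 * Re (cinner (Y e) (T (Y e)))) summable_on E"
      using inj by (intro summable_on_cmult_right) (simp add: summable_on_reindex o_def)
    then show ?thesis using r by (simp add: Y_def lin power2_eq_square)
  qed
  have "(\<lambda>e. Re (cinner (V e) (T (V e))) + Re (cinner (W e) (T (W e)))) summable_on E"
    by (intro summable_on_add diag[of V, OF V] diag[of W, OF W])
  moreover have "cmod (cinner x (T y)) \<le> Re (cinner x (T x)) + Re (cinner y (T y))" for x y
  proof (rule power2_le_imp_le)
    have p: "Re (cinner x (T x)) \<ge> 0" "Re (cinner y (T y)) \<ge> 0" using positive_op_Re[OF pos(1)] by blast+
    have "(cmod (cinner x (T y)))\<^sup>2 \<le> Re (cinner x (T x)) * Re (cinner y (T y))"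
      by (rule positive_op_Cauchy_Schwarz[OF pos(1)])
    also have "\<dots> \<le> (Re (cinner x (T x)) + Re (cinner y (T y)))\<^sup>2"
      using mult_nonneg_nonneg[OF p] by (simp add: power2_sum)
    finally show "(cmod (cinner x (T y)))\<^sup>2 \<le> (Re (cinner x (T x)) + Re (cinner y (T y)))\<^sup>2" .
  qed (use positive_op_Re[OF pos(1)] in simp)
  ultimately show ?case
    by (rule abs_summable_summable[OF Infinite_Sum.abs_summable_on_comparison_test'])
qed (simp_all add: cinner_simps summable_on_add summable_on_cmult_right)

text \<open>Write \<open>A = P - (P - A)\<close>. From \<open>- A \<le> P \<le> 2 P - A + A\<close>
  the operator \<open>P - A\<close> lies between 0 and \<open>2 P\<close>, so it inherits finite
  trace from \<open>P\<close>.\<close>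

lemma nuclear_hermitian_trace_class:
  assumes "hermitian_op A" "trace_class_op A"
  shows "nuclear A"
proof -
  have A: "bounded_clinear A" "adj A = A" using assms(1) by (simp_all add: hermitian_op_def)
  have sym: "cinner (A x) y = cinner x (A y)" for x y using cinner_adj[OF A(1)] by (simp add: A(2))
  obtain P where P: "positive_op P" "P \<circ> P = A \<circ> A" "(\<lambda>e. cinner e (P e)) summable_on some_onb"
    using assms(2) by (auto simp: trace_class_op_def A(2))
  have sq: "P (P x) = A (A x)" for x using P(2) by (simp add: fun_eq_iff)
  have minus: "positive_op (\<lambda>x. P x - A x)" by (rule symmetric_le_modulus[OF P(1) A(1) sym sq])
  \<comment> \<open>\<open>P\<close> is also the modulus of \<open>- A\<close>, because
    \<open>A\<close> and \<open>- A\<close> have the same square.\<close>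
  have plus: "positive_op (\<lambda>x. P x - (- 1) *\<^sub>C A x)"
    by (rule symmetric_le_modulus[OF P(1) bounded_clinear_scale[OF A(1)]])
      (use bounded_clinear_diff[OF A(1), of 0] in \<open>simp_all add: sym sq A(1)\<close>)
  have Psum: "(\<lambda>e. 2 * Re (cinner e (P e))) summable_on some_onb"
    using P(3) by (intro summable_on_cmult_right) (simp add: positive_op_summable_complex_iff[OF P(1)])
  have "nuclear (\<lambda>x. P x - A x)"
  proof (intro nuclear.pos minus)
    show "(\<lambda>e. cinner e (P e - A e)) summable_on some_onb"
      unfolding positive_op_summable_complex_iff[OF minus]
    proof (rule summable_on_comparison_test[OF Psum])
      fix e
      show "Re (cinner e (P e - A e)) \<le> 2 * Re (cinner e (P e))" "0 \<le> Re (cinner e (P e - A e))"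
        using positive_op_Re[OF minus, of e] positive_op_Re[OF plus, of e] by (simp_all add: cinner_simps)
    qed
  qed
  from nuclear_minus[OF nuclear.pos[OF P(1,3)] this] show ?thesis by simp
qed


subsection \<open>Unitary conjugation\<close>

lemma unitary_opD:
  assumes "unitary_op U"
  shows "bounded_clinear U" "bounded_clinear (adj U)" "adj U (U x) = x" "U (adj U x) = x"
  using assms by (auto simp: unitary_op_def bounded_clinear_adj fun_eq_iff)

lemma cinner_unitary_conj:
  "unitary_op U \<Longrightarrow> cinner x (U (T (adj U x))) = cinner (adj U x) (T (adj U x))"
  by (simp add: cinner_adj unitary_opD)

lemma cinner_adj_unitary: "unitary_op U \<Longrightarrow> cinner (adj U x) (adj U y) = cinner x y"
  by (simp add: cinner_adj unitary_opD)

lemma inj_adj_unitary: "unitary_op U \<Longrightarrow> inj_on (adj U) A"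
  by (metis inj_onI unitary_opD(4))

lemma is_onb_adj_unitary:
  assumes U: "unitary_op U" and E: "is_onb E"
  shows "is_onb (adj U ` E)"
proof (rule is_onbI)
  have "orthonormal E" using E is_onb_iff by blast
  then show "orthonormal (adj U ` E)"
    using inj_adj_unitary[OF U, of E]
    by (auto simp: orthonormal_def cinner_adj_unitary[OF U] inj_on_eq_iff)
  fix x assume x: "\<And>b. b \<in> adj U ` E \<Longrightarrow> cinner b x = 0"
  have "U x = 0"
  proof (rule is_onb_total[OF E])
    fix b assume "b \<in> E"
    then show "cinner b (U x) = 0" using x[of "adj U b"] by (simp add: cinner_adj unitary_opD(1)[OF U])
  qed
  then show "x = 0" using unitary_opD(1-3)[OF U] by (metis bounded_clinear_zero)
qed

lemma nuclear_unitary_conj: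
  assumes U: "unitary_op U" and "nuclear T"
  shows "nuclear (U \<circ> T \<circ> adj U)"
  using assms(2)
proof (induction rule: nuclear.induct)
  case (pos T)
  show ?case
  proof (rule nuclear.pos)
    show "positive_op (U \<circ> T \<circ> adj U)"
      using pos(1) bounded_clinear_comp[OF unitary_opD(1)[OF U] bounded_clinear_comp[OF _ unitary_opD(2)[OF U]]]
      by (simp add: positive_op_iff o_def cinner_unitary_conj[OF U])
    have "(\<lambda>f. cinner f (T f)) summable_on adj U ` some_onb"
      using is_onb_adj_unitary[OF U is_onb_some_onb] is_onb_iff
      by (intro nuclear_summable nuclear.pos[OF pos]) blast
    then show "(\<lambda>e. cinner e ((U \<circ> T \<circ> adj U) e)) summable_on some_onb"
      by (simp add: summable_on_reindex inj_adj_unitary[OF U] o_def cinner_unitary_conj[OF U])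
  qed
next
  case (add S T)
  from nuclear.add[OF add.IH] show ?case by (simp add: o_def bounded_clinear_add unitary_opD[OF U])
next
  case (scale T c)
  from nuclear.scale[OF scale.IH, of c] show ?case by (simp add: o_def bounded_clinear_scaleC unitary_opD[OF U])
qed

text \<open>The diagonal of the conjugate in \<open>some_onb\<close> is the diagonal of
  \<open>T\<close> in the rotated basis, so basis independence gives the claim.\<close>

lemma op_trace_unitary_conj:
  assumes U: "unitary_op U" and T: "nuclear T"
  shows "op_trace (U \<circ> T \<circ> adj U) = op_trace T"
proof -
  have "op_trace (U \<circ> T \<circ> adj U) = (\<Sum>\<^sub>\<infinity>f\<in>adj U ` some_onb. cinner f (T f))"
    by (simp add: op_trace_def infsum_reindex inj_adj_unitary[OF U] o_def cinner_unitary_conj[OF U])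
  also have "\<dots> = op_trace T" by (intro nuclear_trace T is_onb_adj_unitary U is_onb_some_onb)
  finally show ?thesis .
qed

text \<open>A divergent \<open>infsum\<close> is 0, so trace one already forces the diagonal to be
  summable.\<close>

lemma density_op_nuclear: "\<rho> \<in> density_ops \<Longrightarrow> nuclear \<rho>"
  unfolding density_ops_def op_trace_def mem_Collect_eq
  by (metis infsum_not_exists nuclear.pos zero_neq_one)

subsection \<open>Finite-dimensional spaces\<close>

lemma finite_orthonormal:
  fixes E :: "'a::chilbert_space set"
  assumes "\<exists>B :: 'a set. finite B \<and> complex_vector.span B = UNIV" and "orthonormal E"
  shows "finite E"
proof -
  have "complex_vector.independent E"
    unfolding complex_vector.independent_explicit_module
  proof (intro allI impI)
    fix t u v assume t: "finite t" "t \<subseteq> E" "(\<Sum>v\<in>t. u v *\<^sub>C v) = 0" "v \<in> t"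
    have "0 = cinner v (\<Sum>w\<in>t. u w *\<^sub>C w)" by (simp add: t)
    also have "\<dots> = (\<Sum>w\<in>t. if v = w then u w else 0)"
      unfolding cinner_sum_right using t by (intro sum.cong) (auto simp: orthonormalD[OF assms(2)] subset_iff)
    also have "\<dots> = u v" using t by simp
    finally show "u v = 0" by simp
  qed
  then show ?thesis using assms(1) complex_vector.independent_span_bound by (metis subset_UNIV)
qed

context
  assumes fin: "\<exists>B :: 's::chilbert_space set. finite B \<and> complex_vector.span B = UNIV"
begin

lemma finite_basis: "finite (some_onb :: 's set)"
  by (rule finite_orthonormal[OF fin orthonormal_some_onb])

lemma basis_expansion: "(\<Sum>e\<in>some_onb. cinner e x *\<^sub>C e) = (x :: 's)"
  by (rule finite_onb_expansion[OF is_onb_some_onb finite_basis])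

lemma clinear_basis_expansion:
  assumes "clinear (X :: 's \<Rightarrow> 'b::chilbert_space)"
  shows "X x = (\<Sum>e\<in>some_onb. cinner e x *\<^sub>C X e)"
proof -
  have X: "X (x + y) = X x + X y" "X (c *\<^sub>C x) = c *\<^sub>C X x" for x y c
    using assms by (simp_all add: clinear_iff)
  have "X 0 = 0" using X(2)[of 0 0] by simp
  then have "X (sum g I) = (\<Sum>i\<in>I. X (g i))" for g and I :: "'s set"
    by (induction I rule: infinite_finite_induct) (simp_all add: X(1))
  then show ?thesis by (subst basis_expansion[of x, symmetric]) (simp add: X(2))
qed

lemma clinear_bounded_clinear:
  assumes "clinear (X :: 's \<Rightarrow> 'b::chilbert_space)"
  shows "bounded_clinear X"
proof -
  have "bounded_clinear (\<lambda>x. \<Sum>e\<in>some_onb. cinner e x *\<^sub>C X e)"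
    by (intro bounded_clinear_finite_sum bounded_clinear_rank_one)
  then show ?thesis by (simp flip: clinear_basis_expansion[OF assms])
qed

lemma op_trace_finite: "op_trace X = (\<Sum>e\<in>(some_onb :: 's set). cinner e (X e))"
  by (simp add: op_trace_def infsum_finite finite_basis)

text \<open>A positive operator is its own modulus, and in finite dimension its trace is a finite
  sum.\<close>

lemma positive_op_density:
  assumes X: "positive_op (X :: 's \<Rightarrow> 's)" and "op_trace X = 1"
  shows "X \<in> density_ops"
proof -
  have "adj X = X"
    by (rule adj_eqI[OF positive_op_symmetric[OF X] positive_op_bounded_clinear[OF X]])
  then have "trace_class_op X"
    unfolding trace_class_op_def
    by (intro conjI exI[of _ X] positive_op_bounded_clinear[OF X] X)
      (simp_all add: finite_basis summable_on_finite)
  with assms show ?thesis by (simp add: density_ops_def)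
qed

end

subsection \<open>Tensor products\<close>

context
  fixes tens :: "'s::chilbert_space \<Rightarrow> 'e::chilbert_space \<Rightarrow> 'k::chilbert_space"
  assumes tens: "is_hilbert_tensor tens"
begin

lemma cinner_tens: "cinner (tens x y) (tens x' y') = cinner x x' * cinner y y'"
  using tens unfolding is_hilbert_tensor_def by blast

lemma norm_tens: "norm (tens x y) = norm x * norm y"
proof -
  have "complex_of_real ((norm (tens x y))\<^sup>2) = of_real ((norm x * norm y)\<^sup>2)"
    using cinner_tens[of x y x y] by (simp add: cinner_self power_mult_distrib)
  then show ?thesis unfolding of_real_eq_iff by simp
qed

lemma bounded_clinear_tens: "bounded_clinear (tens x)"
  using tens by (auto simp: is_hilbert_tensor_def bounded_clinear_def norm_tens)

lemma bounded_clinear_tens_left: "bounded_clinear (\<lambda>x. tens x y)"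
  using tens by (auto simp: is_hilbert_tensor_def bounded_clinear_def norm_tens mult.commute)

lemmas tens_simps = bounded_clinear_add[OF bounded_clinear_tens] bounded_clinear_scaleC[OF bounded_clinear_tens]
  bounded_clinear_add[OF bounded_clinear_tens_left] bounded_clinear_scaleC[OF bounded_clinear_tens_left]

text \<open>\<open>adj (tens x)\<close> is the contraction of the first factor with
  \<open>x\<close>, that is \<open><x| \<otimes> id\<close>; operators on the product are assembled
  from it below.\<close>

lemma adj_tens: "adj (tens x) (tens x' y) = cinner x x' *\<^sub>C y"
  by (rule cinner_ext_left[OF sym]) (simp add: cinner_adj[OF bounded_clinear_tens] cinner_tens cinner_commute[of x' x])

lemma adj_tens_add: "adj (tens (x + y)) z = adj (tens x) z + adj (tens y) z"
  and adj_tens_scaleC: "adj (tens (c *\<^sub>C x)) z = cnj c *\<^sub>C adj (tens x) z"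
  by (rule cinner_ext_left; simp add: cinner_adj[OF bounded_clinear_tens] cinner_simps tens_simps)+

lemma tens_total:
  assumes "\<And>x y. cinner (tens x y) z = 0"
  shows "z = 0"
  by (rule dense_span_total[of "{tens x y |x y. True}"])
    (use tens assms in \<open>auto simp: is_hilbert_tensor_def\<close>)

lemma inj_on_tens_onb: "inj_on (\<lambda>(x, y). tens x y) (some_onb \<times> some_onb)"
proof (rule inj_onI, clarify)
  fix x :: 's and y :: 'e and x' y'
  assume in_onb: "x \<in> some_onb" "y \<in> some_onb" "x' \<in> some_onb" "y' \<in> some_onb" and eq: "tens x y = tens x' y'"
  have "cinner x x' * cinner y y' = cinner x x * cinner y y"
    using cinner_tens[of x y x' y'] cinner_tens[of x y x y] eq by simp
  then show "x = x' \<and> y = y'"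
    using in_onb by (auto simp: orthonormalD[OF orthonormal_some_onb] split: if_splits)
qed

lemma is_onb_tens: "is_onb ((\<lambda>(x, y). tens x y) ` (some_onb \<times> some_onb))"
proof (rule is_onbI)
  show "orthonormal ((\<lambda>(x, y). tens x y) ` (some_onb \<times> some_onb))"
    unfolding orthonormal_def
  proof clarify
    fix e e' :: 's and f f' :: 'e
    assume in_onb: "e \<in> some_onb" "f \<in> some_onb" "e' \<in> some_onb" "f' \<in> some_onb"
    then have "tens e f = tens e' f' \<longleftrightarrow> e = e' \<and> f = f'"
      using inj_onD[OF inj_on_tens_onb, of "(e, f)" "(e', f')"] by auto
    then show "cinner (tens e f) (tens e' f') = (if tens e f = tens e' f' then 1 else 0)"
      using in_onb by (simp add: cinner_tens orthonormalD[OF orthonormal_some_onb])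
  qed
  fix z assume z: "\<And>b. b \<in> (\<lambda>(x, y). tens x y) ` (some_onb \<times> some_onb) \<Longrightarrow> cinner b z = 0"
  show "z = 0"
  proof (rule tens_total)
    fix x y
    \<comment> \<open>Totality is reached one factor at a time: contracting with a basis vector of
      the system leaves an environment vector orthogonal to a basis, and then the roles
      change.\<close>
    have "adj (tens e) z = 0" if "e \<in> some_onb" for e
    proof (rule is_onb_total[OF is_onb_some_onb])
      fix f :: 'e assume "f \<in> some_onb"
      with that have "cinner (tens e f) z = 0" by (intro z) auto
      then show "cinner f (adj (tens e) z) = 0" by (simp add: cinner_adj_right[OF bounded_clinear_tens])
    qed
    then have "cinner (tens e y) z = 0" if "e \<in> some_onb" for e
      using that by (metis cinner_adj_right[OF bounded_clinear_tens] cinner_zero(1))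
    then have "adj (\<lambda>x. tens x y) z = 0"
      by (intro is_onb_total[OF is_onb_some_onb]) (simp add: cinner_adj_right[OF bounded_clinear_tens_left])
    then show "cinner (tens x y) z = 0"
      using cinner_adj_right[OF bounded_clinear_tens_left, of x y z] by simp
  qed
qed

text \<open>The range of the adjoint of the difference is orthogonal to all elementary tensors,
  hence zero. This is the uniqueness behind \<open>op_tensor\<close>.\<close>

lemma bounded_clinear_tens_ext:
  assumes "bounded_clinear A" "bounded_clinear B" and eq: "\<And>x y. A (tens x y) = B (tens x y)"
  shows "A = B"
proof
  fix z :: 'k
  define D where "D x = A x - B x" for x
  have D: "bounded_clinear D" unfolding D_def by (intro bounded_clinear_minus assms)
  have "adj D w = 0" for w
    by (rule tens_total) (simp add: cinner_adj_right[OF D] D_def eq)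
  then have "cinner w (D z) = 0" for w
    by (metis cinner_adj[OF D] cinner_zero(2))
  then have "D z = 0" by (intro cinner_ext) simp
  then show "A z = B z" by (simp add: D_def)
qed

lemma op_tensor_eqI:
  assumes "bounded_clinear T" and "\<And>x y. T (tens x y) = tens (X x) (B y)"
  shows "op_tensor tens X B = T"
  unfolding op_tensor_def
proof (rule the_equality)
  fix T' assume "bounded_clinear T' \<and> (\<forall>x y. T' (tens x y) = tens (X x) (B y))"
  then show "T' = T" using assms by (intro bounded_clinear_tens_ext) auto
qed (simp add: assms)

text \<open>The matrix elements in \<open>ptrace_E\<close>, named separately because their
  convergence and sesquilinearity precede the existence of an operator that has them.\<close>

definition ptrace_form :: "('k \<Rightarrow> 'k) \<Rightarrow> 's \<Rightarrow> 's \<Rightarrow> complex"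
  where "ptrace_form T \<phi> \<psi> = (\<Sum>\<^sub>\<infinity>f\<in>some_onb. cinner (tens \<phi> f) (T (tens \<psi> f)))"

lemma nuclear_ptrace_summable:
  "nuclear T \<Longrightarrow> (\<lambda>f. cinner (tens \<phi> f) (T (tens \<psi> f))) summable_on some_onb"
  by (rule nuclear_matrix_summable[OF _ orthonormal_some_onb cinner_tens cinner_tens])

lemma ptrace_form_simps:
  assumes T: "nuclear T"
  shows "ptrace_form T (\<phi> + \<phi>') \<psi> = ptrace_form T \<phi> \<psi> + ptrace_form T \<phi>' \<psi>"
    and "ptrace_form T \<phi> (\<psi> + \<psi>') = ptrace_form T \<phi> \<psi> + ptrace_form T \<phi> \<psi>'"
    and "ptrace_form T (c *\<^sub>C \<phi>) \<psi> = cnj c * ptrace_form T \<phi> \<psi>"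
    and "ptrace_form T \<phi> (c *\<^sub>C \<psi>) = c * ptrace_form T \<phi> \<psi>"
  unfolding ptrace_form_def
  by (simp_all add: tens_simps bounded_clinear_add[OF nuclear_bounded_clinear[OF T]]
      bounded_clinear_scaleC[OF nuclear_bounded_clinear[OF T]] cinner_simps
      infsum_add nuclear_ptrace_summable[OF T] infsum_cmult_right')

lemma ptrace_E_eqI:
  assumes "\<And>\<phi> \<psi>. cinner \<phi> (A \<psi>) = ptrace_form T \<phi> \<psi>"
  shows "ptrace_E tens T = A"
  unfolding ptrace_E_def ptrace_form_def[symmetric]
proof (rule the_equality)
  fix A' assume "\<forall>\<phi> \<psi>. cinner \<phi> (A' \<psi>) = ptrace_form T \<phi> \<psi>"
  then show "A' = A" by (intro ext cinner_ext) (simp add: assms)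
qed (simp add: assms)

context
  assumes fin: "\<exists>B :: 's set. finite B \<and> complex_vector.span B = UNIV"
begin

text \<open>The operator is \<open>|v><v| \<otimes> \<rho>\<close>. Its diagonal in the product
  basis factors as \<open>|<v, e>|^2 * <f, \<rho> f>\<close>, summable because the system basis is
  finite and \<open>\<rho>\<close> has finite trace.\<close>

lemma nuclear_tens_diag:
  assumes "\<rho> \<in> density_ops"
  shows "nuclear (\<lambda>z. tens v (\<rho> (adj (tens v) z)))"
proof (rule nuclear_positiveI[OF _ is_onb_tens])
  have \<rho>: "positive_op \<rho>" using assms by (simp add: density_ops_def)
  note bcl = positive_op_bounded_clinear[OF \<rho>]
  have quad: "cinner z (tens v (\<rho> (adj (tens v) z))) = cinner (adj (tens v) z) (\<rho> (adj (tens v) z))" for z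
    by (simp add: cinner_adj[OF bounded_clinear_tens])
  show "positive_op (\<lambda>z. tens v (\<rho> (adj (tens v) z)))"
    using \<rho> bounded_clinear_comp[OF bounded_clinear_tens
        bounded_clinear_comp[OF bcl bounded_clinear_adj[OF bounded_clinear_tens]], of v v]
    by (simp add: positive_op_iff quad)
  have "(\<lambda>f. cinner f (\<rho> f)) summable_on some_onb"
    by (intro nuclear_summable density_op_nuclear assms orthonormal_some_onb)
  then have "(\<lambda>f. cmod (cinner f (\<rho> f))) summable_on some_onb"
    by (rule iffD1[OF summable_on_iff_abs_summable_on_complex])
  then have "(\<lambda>p. cmod (cnj (cinner v (fst p)) * cinner v (fst p) * cinner (snd p) (\<rho> (snd p))))
      summable_on some_onb \<times> some_onb"
    unfolding Infinite_Sum.abs_summable_on_Sigma_iff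
    by (auto simp: norm_mult intro: summable_on_cmult_right summable_on_finite[OF finite_basis[OF fin]])
  then have "(\<lambda>(e, f). cnj (cinner v e) * cinner v e * cinner f (\<rho> f)) summable_on some_onb \<times> some_onb"
    unfolding case_prod_unfold by (rule abs_summable_summable)
  then show "(\<lambda>b. cinner b (tens v (\<rho> (adj (tens v) b)))) summable_on (\<lambda>(x, y). tens x y) ` (some_onb \<times> some_onb)"
    unfolding summable_on_reindex[OF inj_on_tens_onb]
    by (simp add: o_def case_prod_unfold quad adj_tens bounded_clinear_scaleC[OF bcl] mult_ac)
qed

text \<open>Polarization of the sesquilinear map \<open>(a, b) \<mapsto> tens a \<circ> \<rho> \<circ> adj (tens b)\<close>.\<close>

lemma nuclear_tens_offdiag:
  assumes \<rho>: "\<rho> \<in> density_ops"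
  shows "nuclear (\<lambda>z. tens a (\<rho> (adj (tens b) z)))"
proof -
  define Q where "Q v z = tens v (\<rho> (adj (tens v) z))" for v z
  define M where "M v w z = tens v (\<rho> (adj (tens w) z))" for v w z
  have Q: "nuclear (Q v)" for v unfolding Q_def by (rule nuclear_tens_diag[OF \<rho>])
  have "bounded_clinear \<rho>" by (intro nuclear_bounded_clinear density_op_nuclear \<rho>)
  note lin = bounded_clinear_add[OF this] bounded_clinear_scaleC[OF this]
  \<comment> \<open>Summed over the fourth roots of unity, \<open>c\<close>, \<open>c * c\<close>
    and \<open>c * c * cnj c\<close> give 0 while \<open>c * cnj c\<close> gives 4, so only the term
    \<open>M a b\<close> survives in \<open>R\<close>.\<close>
  have QM: "c *\<^sub>C Q (a + c *\<^sub>C b) z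
      = c *\<^sub>C Q a z + (c * c) *\<^sub>C M b a z + (c * cnj c) *\<^sub>C M a b z + (c * c * cnj c) *\<^sub>C Q b z" for c z
    by (simp add: Q_def M_def adj_tens_add adj_tens_scaleC tens_simps lin scaleC_add_right scaleC_scaleC mult_ac add_ac)
  have four: "4 *\<^sub>C x = x + x + x + x" for x :: 'k
    using scaleC_add_left[of 2 2 x] scaleC_add_left[of 1 1 x] by (simp add: add.assoc)
  define R where "R z = 1 *\<^sub>C Q (a + 1 *\<^sub>C b) z + (- 1) *\<^sub>C Q (a + (- 1) *\<^sub>C b) z
      + \<i> *\<^sub>C Q (a + \<i> *\<^sub>C b) z + (- \<i>) *\<^sub>C Q (a + (- \<i>) *\<^sub>C b) z" for z
  have "R z = 4 *\<^sub>C M a b z" for z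
    unfolding R_def QM four by (simp add: algebra_simps)
  then have "M a b = (\<lambda>z. (1/4) *\<^sub>C R z)" by (simp add: scaleC_scaleC)
  moreover have "nuclear R" unfolding R_def by (intro nuclear.scale nuclear.add Q)
  ultimately have "nuclear (M a b)" using nuclear.scale by metis
  then show ?thesis by (simp only: M_def[abs_def])
qed

text \<open>Expanding \<open>X\<close> in matrix units turns \<open>X \<otimes> B\<close> into a
  finite sum of terms \<open>|i><j| \<otimes> B\<close>; this gives existence and reduces nuclearity
  to single terms.\<close>

lemma op_tensor_explicit:
  assumes X: "clinear X" and B: "bounded_clinear B"
  shows "bounded_clinear (op_tensor tens X B)"
    and "op_tensor tens X B (tens x y) = tens (X x) (B y)"
    and "op_tensor tens X B
      = (\<lambda>z. \<Sum>i\<in>some_onb. \<Sum>j\<in>some_onb. cinner i (X j) *\<^sub>C tens i (B (adj (tens j) z)))"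
proof -
  define T where
    "T = (\<lambda>z. \<Sum>i\<in>some_onb. \<Sum>j\<in>some_onb. cinner i (X j) *\<^sub>C tens i (B (adj (tens j) z)))"
  have Tb: "bounded_clinear T"
    unfolding T_def
    by (intro bounded_clinear_finite_sum bounded_clinear_scale bounded_clinear_comp[OF bounded_clinear_tens]
        bounded_clinear_comp[OF B] bounded_clinear_adj bounded_clinear_tens)
  have Tt: "T (tens x y) = tens (X x) (B y)" for x y
  proof -
    have "X x = (\<Sum>i\<in>some_onb. cinner i (X x) *\<^sub>C i)" by (simp add: basis_expansion[OF fin])
    also have "\<dots> = (\<Sum>i\<in>some_onb. (\<Sum>j\<in>some_onb. cinner j x * cinner i (X j)) *\<^sub>C i)"
      by (subst clinear_basis_expansion[OF fin X, of x]) (simp add: cinner_sum_right)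
    finally have "tens (X x) (B y) = (\<Sum>i\<in>some_onb. (\<Sum>j\<in>some_onb. cinner j x * cinner i (X j)) *\<^sub>C tens i (B y))"
      by (simp add: bounded_clinear_sum[OF bounded_clinear_tens_left] tens_simps)
    also have "\<dots> = T (tens x y)"
      by (simp add: T_def adj_tens bounded_clinear_scaleC[OF B] tens_simps scaleC_scaleC
          complex_vector.scale_sum_left mult.commute)
    finally show ?thesis by simp
  qed
  have eq: "op_tensor tens X B = T" by (rule op_tensor_eqI[OF Tb Tt])
  show "bounded_clinear (op_tensor tens X B)" "op_tensor tens X B (tens x y) = tens (X x) (B y)"
    by (simp_all add: eq Tb Tt)
  show "op_tensor tens X B
      = (\<lambda>z. \<Sum>i\<in>some_onb. \<Sum>j\<in>some_onb. cinner i (X j) *\<^sub>C tens i (B (adj (tens j) z)))"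
    unfolding eq T_def ..
qed

lemma nuclear_op_tensor:
  assumes "clinear X" and "\<rho> \<in> density_ops"
  shows "nuclear (op_tensor tens X \<rho>)"
  unfolding op_tensor_explicit(3)[OF assms(1) nuclear_bounded_clinear[OF density_op_nuclear[OF assms(2)]]]
  by (intro nuclear_sum nuclear.scale nuclear_tens_offdiag assms)

text \<open>The finite system basis rebuilds an operator from the sesquilinear form, so the
  \<open>THE\<close> in \<open>ptrace_E\<close> denotes.\<close>

lemma cinner_ptrace_E:
  assumes T: "nuclear T"
  shows "cinner \<phi> (ptrace_E tens T \<psi>) = ptrace_form T \<phi> \<psi>"
proof -
  define A where "A \<psi> = (\<Sum>e\<in>some_onb. ptrace_form T e \<psi> *\<^sub>C e)" for \<psi>
  have zero: "ptrace_form T 0 \<psi> = 0" for \<psi>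
    using ptrace_form_simps(3)[OF T, of 0 0 \<psi>] by simp
  have sum: "ptrace_form T (sum g I) \<psi> = (\<Sum>i\<in>I. ptrace_form T (g i) \<psi>)" for g and I :: "'s set" and \<psi>
    by (induction I rule: infinite_finite_induct) (simp_all add: zero ptrace_form_simps(1)[OF T])
  have A: "cinner \<phi> (A \<psi>) = ptrace_form T \<phi> \<psi>" for \<phi> \<psi>
  proof -
    have "ptrace_form T \<phi> \<psi> = (\<Sum>e\<in>some_onb. cnj (cinner e \<phi>) * ptrace_form T e \<psi>)"
      by (subst basis_expansion[OF fin, of \<phi>, symmetric]) (simp add: sum ptrace_form_simps(3)[OF T])
    then show ?thesis
      by (simp add: A_def cinner_sum_right mult.commute flip: cinner_commute)
  qed
  show ?thesis by (simp add: ptrace_E_eqI[OF A] A)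
qed

lemma clinear_ptrace_E: "nuclear T \<Longrightarrow> clinear (ptrace_E tens T)"
  unfolding clinear_iff
  by (intro conjI allI cinner_ext) (simp_all add: cinner_simps cinner_ptrace_E ptrace_form_simps)

lemma ptrace_E_add:
  "nuclear S \<Longrightarrow> nuclear T \<Longrightarrow> ptrace_E tens (S + T) = ptrace_E tens S + ptrace_E tens T"
  by (rule ptrace_E_eqI)
    (simp add: cinner_simps cinner_ptrace_E ptrace_form_def infsum_add nuclear_ptrace_summable)

lemma ptrace_E_scale: "nuclear T \<Longrightarrow> ptrace_E tens (c *\<^sub>C T) = c *\<^sub>C ptrace_E tens T"
  by (rule ptrace_E_eqI)
    (simp add: scaleC_fun_def cinner_ptrace_E ptrace_form_def infsum_cmult_right')

text \<open>The iterated sum is the double sum over the product basis, by joint summability, and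
  that is the trace in another basis of the product space.\<close>

lemma op_trace_ptrace_E:
  assumes T: "nuclear T"
  shows "op_trace (ptrace_E tens T) = op_trace T"
proof -
  let ?B = "(\<lambda>(x, y). tens x y) ` (some_onb \<times> some_onb)"
  have "(\<lambda>b. cinner b (T b)) summable_on ?B"
    using is_onb_tens is_onb_iff by (intro nuclear_summable T) blast
  then have summ: "(\<lambda>(e, f). cinner (tens e f) (T (tens e f))) summable_on some_onb \<times> some_onb"
    unfolding summable_on_reindex[OF inj_on_tens_onb] by (simp add: o_def case_prod_unfold)
  have "op_trace (ptrace_E tens T)
      = (\<Sum>\<^sub>\<infinity>e\<in>some_onb. \<Sum>\<^sub>\<infinity>f\<in>some_onb. cinner (tens e f) (T (tens e f)))"
    by (simp add: op_trace_def cinner_ptrace_E[OF T] ptrace_form_def)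
  also have "\<dots> = (\<Sum>\<^sub>\<infinity>(e, f)\<in>some_onb \<times> some_onb. cinner (tens e f) (T (tens e f)))"
    by (rule infsum_Sigma'_banach[OF summ])
  also have "\<dots> = (\<Sum>\<^sub>\<infinity>b\<in>?B. cinner b (T b))"
    unfolding infsum_reindex[OF inj_on_tens_onb] by (simp add: o_def case_prod_unfold)
  also have "\<dots> = op_trace T" by (rule nuclear_trace[OF T is_onb_tens])
  finally show ?thesis .
qed

text \<open>Together with trace preservation of \<open>ptrace_E\<close>, this yields that
  \<open>X \<otimes> \<rho>\<close> has the trace of \<open>X\<close>.\<close>

lemma ptrace_E_op_tensor:
  assumes X: "clinear X" and \<rho>: "\<rho> \<in> density_ops"
  shows "ptrace_E tens (op_tensor tens X \<rho>) = X"
proof (rule ptrace_E_eqI)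
  fix \<phi> \<psi>
  have "ptrace_form (op_tensor tens X \<rho>) \<phi> \<psi> = cinner \<phi> (X \<psi>) * op_trace \<rho>"
    by (simp add: ptrace_form_def op_trace_def cinner_tens infsum_cmult_right'
        op_tensor_explicit(2)[OF X nuclear_bounded_clinear[OF density_op_nuclear[OF \<rho>]]])
  then show "cinner \<phi> (X \<psi>) = ptrace_form (op_tensor tens X \<rho>) \<phi> \<psi>"
    using \<rho> by (simp add: density_ops_def)
qed

lemma positive_op_ptrace_E:
  assumes T: "nuclear T" "positive_op T"
  shows "positive_op (ptrace_E tens T)"
  unfolding positive_op_iff
proof (intro conjI allI)
  show "bounded_clinear (ptrace_E tens T)"
    by (intro clinear_bounded_clinear[OF fin] clinear_ptrace_E T)
  fix x
  show "0 \<le> Re (cinner x (ptrace_E tens T x))"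
    unfolding cinner_ptrace_E[OF T(1)] ptrace_form_def infsum_Re[OF nuclear_ptrace_summable[OF T(1)], symmetric]
    by (intro infsum_nonneg positive_op_Re[OF T(2)])
  show "Im (cinner x (ptrace_E tens T x)) = 0"
    unfolding cinner_ptrace_E[OF T(1)] ptrace_form_def infsum_Im[OF nuclear_ptrace_summable[OF T(1)], symmetric]
    by (simp add: positive_op_Im[OF T(2)])
qed

end

end


subsection \<open>Linear maps on operators\<close>

lemma linear_ops_add: "X \<in> linear_ops \<Longrightarrow> Y \<in> linear_ops \<Longrightarrow> X + Y \<in> linear_ops"
  and linear_ops_scaleC: "X \<in> linear_ops \<Longrightarrow> c *\<^sub>C X \<in> linear_ops"
  by (simp_all add: linear_ops_def clinear_iff scaleC_fun_def scaleC_add_right scaleC_scaleC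
      algebra_simps)

text \<open>An operator of nonzero trace is a multiple of a trace-one operator; a traceless
  \<open>X\<close> is \<open>(X + P) - P\<close> with \<open>P\<close> a rank-one projection of
  trace one.\<close>

lemma linear_map_on_ops_unique:
  fixes \<Lambda> M :: "('s::chilbert_space \<Rightarrow> 's) \<Rightarrow> ('s \<Rightarrow> 's)"
  assumes fin: "\<exists>B :: 's set. finite B \<and> complex_vector.span B = UNIV"
    and \<Lambda>: "linear_map_on_ops \<Lambda>" and M: "linear_map_on_ops M"
    and agree: "\<And>X. X \<in> trace_one_ops \<Longrightarrow> \<Lambda> X = M X" and X: "X \<in> linear_ops"
  shows "\<Lambda> X = M X"
\<comment> \<open>The zero space has no trace-one operator, but all maps into it agree.\<close>
proof (cases "(some_onb :: 's set) = {}")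
  case True
  then have "x = 0" for x :: 's using basis_expansion[OF fin, of x] by simp
  then show ?thesis by (metis ext)
next
  case False
  have tr_add: "op_trace (Y + Z) = op_trace Y + op_trace Z" for Y Z :: "'s \<Rightarrow> 's"
    by (simp add: op_trace_finite[OF fin] cinner_simps sum.distrib)
  have tr_scale: "op_trace (c *\<^sub>C Y) = c * op_trace Y" for c and Y :: "'s \<Rightarrow> 's"
    by (simp add: scaleC_fun_def op_trace_scale)
  have agree_nonzero: "\<Lambda> Y = M Y" if Y: "Y \<in> linear_ops" "op_trace Y \<noteq> 0" for Y
  proof -
    define Z where "Z = (1 / op_trace Y) *\<^sub>C Y"
    have "Z \<in> linear_ops" "op_trace Z = 1" using Y by (simp_all add: Z_def linear_ops_scaleC tr_scale)
    then have "\<Lambda> Z = M Z" by (intro agree) (simp add: trace_one_ops_def)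
    moreover have "Y = op_trace Y *\<^sub>C Z" using Y(2) by (simp add: Z_def scaleC_fun_def scaleC_scaleC)
    ultimately show ?thesis using \<Lambda> M \<open>Z \<in> linear_ops\<close> unfolding linear_map_on_ops_def by metis
  qed
  from False obtain e :: 's where e: "e \<in> some_onb" by blast
  define P where "P x = cinner e x *\<^sub>C e" for x
  have P: "P \<in> linear_ops"
    by (simp add: linear_ops_def clinear_iff P_def cinner_simps scaleC_add_left scaleC_scaleC)
  have "op_trace P = (\<Sum>f\<in>some_onb. if f = e then 1 else 0)"
    unfolding op_trace_finite[OF fin] P_def
    by (intro sum.cong refl) (use e in \<open>auto simp: orthonormalD[OF orthonormal_some_onb]\<close>)
  also have "\<dots> = 1" using e finite_basis[OF fin] by simp
  finally have trP: "op_trace P = 1" .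
  show ?thesis
  proof (cases "op_trace X = 0")
    case True
    then have "\<Lambda> (X + P) = M (X + P)" "\<Lambda> P = M P"
      by (intro agree_nonzero linear_ops_add X P; simp add: tr_add trP)+
    then have "\<Lambda> X + \<Lambda> P = M X + \<Lambda> P"
      using \<Lambda> M X P unfolding linear_map_on_ops_def by metis
    then show ?thesis by (simp add: fun_eq_iff)
  qed (rule agree_nonzero[OF X])
qed

section \<open>The reduced dynamics for a fixed environment state and correlation operator\<close>

context
  fixes tens :: "'s::chilbert_space \<Rightarrow> 'e::chilbert_space \<Rightarrow> 'k::chilbert_space"
    and U chi :: "'k \<Rightarrow> 'k"
    and \<rho>\<^sub>E :: "'e \<Rightarrow> 'e"
  assumes fin: "\<exists>B :: 's set. finite B \<and> complex_vector.span B = UNIV"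
    and tens: "is_hilbert_tensor tens"
    and U: "unitary_op U"
    and \<rho>: "\<rho>\<^sub>E \<in> density_ops"
    and chi: "nuclear chi"
begin

lemma nuclear_Phi: "clinear X \<Longrightarrow> nuclear (U \<circ> op_tensor tens X \<rho>\<^sub>E \<circ> adj U)"
  by (intro nuclear_unitary_conj U nuclear_op_tensor tens fin \<rho>)

lemma op_trace_Phi:
  assumes "clinear X"
  shows "op_trace (Phi tens U \<rho>\<^sub>E X) = op_trace X"
proof -
  have "op_trace (Phi tens U \<rho>\<^sub>E X) = op_trace (op_tensor tens X \<rho>\<^sub>E)"
    unfolding Phi_def
    by (simp add: op_trace_ptrace_E[OF tens fin nuclear_Phi[OF assms]]
        op_trace_unitary_conj[OF U nuclear_op_tensor[OF tens fin assms \<rho>]])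
  also have "\<dots> = op_trace X"
    by (simp add: ptrace_E_op_tensor[OF tens fin assms \<rho>]
        flip: op_trace_ptrace_E[OF tens fin nuclear_op_tensor[OF tens fin assms \<rho>]])
  finally show ?thesis .
qed

lemma op_tensor_add:
  assumes "clinear X" "clinear Y"
  shows "op_tensor tens (X + Y) \<rho>\<^sub>E = op_tensor tens X \<rho>\<^sub>E + op_tensor tens Y \<rho>\<^sub>E"
proof -
  note * = op_tensor_explicit[OF tens fin _ nuclear_bounded_clinear[OF density_op_nuclear[OF \<rho>]]]
  show ?thesis
    by (rule op_tensor_eqI[OF tens])
      (simp_all add: func_plus bounded_clinear_plus *(1,2) assms tens_simps[OF tens])
qed

lemma op_tensor_scaleC:
  assumes "clinear X"
  shows "op_tensor tens (c *\<^sub>C X) \<rho>\<^sub>E = c *\<^sub>C op_tensor tens X \<rho>\<^sub>E"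
proof -
  note * = op_tensor_explicit[OF tens fin _ nuclear_bounded_clinear[OF density_op_nuclear[OF \<rho>]]]
  show ?thesis
    by (rule op_tensor_eqI[OF tens])
      (simp_all add: scaleC_fun_def bounded_clinear_scale *(1,2) assms tens_simps[OF tens])
qed

lemma linear_map_on_ops_Phi: "linear_map_on_ops (Phi tens U \<rho>\<^sub>E)"
  unfolding linear_map_on_ops_def linear_ops_def
proof (intro conjI ballI allI; unfold mem_Collect_eq)
  fix X Y :: "'s \<Rightarrow> 's" and c
  assume X: "clinear X"
  show "clinear (Phi tens U \<rho>\<^sub>E X)"
    unfolding Phi_def by (intro clinear_ptrace_E tens fin nuclear_Phi X)
  have "U \<circ> op_tensor tens (c *\<^sub>C X) \<rho>\<^sub>E \<circ> adj U = c *\<^sub>C (U \<circ> op_tensor tens X \<rho>\<^sub>E \<circ> adj U)"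
    unfolding op_tensor_scaleC[OF X]
    by (simp add: fun_eq_iff scaleC_fun_def bounded_clinear_scaleC unitary_opD(1)[OF U])
  then show "Phi tens U \<rho>\<^sub>E (c *\<^sub>C X) = c *\<^sub>C Phi tens U \<rho>\<^sub>E X"
    unfolding Phi_def by (simp add: ptrace_E_scale tens fin nuclear_Phi X)
  assume Y: "clinear Y"
  have "U \<circ> op_tensor tens (X + Y) \<rho>\<^sub>E \<circ> adj U
      = (U \<circ> op_tensor tens X \<rho>\<^sub>E \<circ> adj U) + (U \<circ> op_tensor tens Y \<rho>\<^sub>E \<circ> adj U)"
    by (simp add: op_tensor_add X Y fun_eq_iff bounded_clinear_add unitary_opD(1)[OF U])
  then show "Phi tens U \<rho>\<^sub>E (X + Y) = Phi tens U \<rho>\<^sub>E X + Phi tens U \<rho>\<^sub>E Y"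
    unfolding Phi_def by (simp add: ptrace_E_add tens fin nuclear_Phi X Y)
qed

lemma I_chi_in_linear_ops: "I_chi tens U chi \<in> linear_ops"
  unfolding I_chi_def linear_ops_def
  using clinear_ptrace_E[OF tens fin nuclear_unitary_conj[OF U chi]] by simp

lemma linear_map_on_ops_Psi_chi: "linear_map_on_ops (Psi_chi tens U \<rho>\<^sub>E chi)"
proof -
  have "op_trace (X + Y) = op_trace X + op_trace Y" for X Y :: "'s \<Rightarrow> 's"
    by (simp add: op_trace_finite[OF fin] cinner_simps sum.distrib)
  moreover have "op_trace (c *\<^sub>C X) = c * op_trace X" for c and X :: "'s \<Rightarrow> 's"
    by (simp add: scaleC_fun_def op_trace_scale)
  ultimately show ?thesis
    using linear_map_on_ops_Phi I_chi_in_linear_ops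
    unfolding linear_map_on_ops_def Psi_chi_def
    by (simp add: linear_ops_add linear_ops_scaleC)
      (simp add: fun_eq_iff scaleC_fun_def scaleC_add_left scaleC_add_right scaleC_scaleC)
qed

lemma op_trace_I_chi:
  assumes "ptrace_E tens chi = 0"
  shows "op_trace (I_chi tens U chi) = 0"
proof -
  have "op_trace (I_chi tens U chi) = op_trace (ptrace_E tens chi)"
    by (simp add: I_chi_def op_trace_ptrace_E[OF tens fin] nuclear_unitary_conj[OF U chi] chi
        op_trace_unitary_conj[OF U])
  then show ?thesis by (simp add: assms op_trace_finite[OF fin])
qed

lemma op_trace_Psi_chi:
  assumes "ptrace_E tens chi = 0" "X \<in> linear_ops"
  shows "op_trace (Psi_chi tens U \<rho>\<^sub>E chi X) = op_trace X"
proof -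
  have "op_trace (Psi_chi tens U \<rho>\<^sub>E chi X) = op_trace (Phi tens U \<rho>\<^sub>E X) + op_trace X * op_trace (I_chi tens U chi)"
    by (simp add: Psi_chi_def scaleC_fun_def op_trace_finite[OF fin] cinner_simps sum.distrib
        flip: sum_distrib_left)
  then show ?thesis using assms by (simp add: op_trace_Phi op_trace_I_chi linear_ops_def)
qed

text \<open>At trace one, linearity of the partial trace merges both terms of \<open>Psi_chi\<close>
  into the partial trace of a single conjugated operator, which is positive by the definition of the
  physical domain.\<close>

lemma Psi_chi_physical_domain:
  assumes "ptrace_E tens chi = 0" "\<rho>\<^sub>S \<in> physical_domain tens \<rho>\<^sub>E chi"
  shows "Psi_chi tens U \<rho>\<^sub>E chi \<rho>\<^sub>S \<in> density_ops"
proof -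
  define T where "T = op_tensor tens \<rho>\<^sub>S \<rho>\<^sub>E + chi"
  have S: "\<rho>\<^sub>S \<in> density_ops" and T: "positive_op T"
    using assms(2) by (auto simp: physical_domain_def T_def)
  have lin: "clinear \<rho>\<^sub>S" and tr: "op_trace \<rho>\<^sub>S = 1"
    using S by (auto simp: density_ops_def positive_op_def bounded_clinear_def)
  have "nuclear T"
    using nuclear.add[OF nuclear_op_tensor[OF tens fin lin \<rho>] chi] by (simp add: T_def func_plus)
  note UT = nuclear_unitary_conj[OF U this]
  have "U \<circ> T \<circ> adj U = (U \<circ> op_tensor tens \<rho>\<^sub>S \<rho>\<^sub>E \<circ> adj U) + (U \<circ> chi \<circ> adj U)"
    by (simp add: T_def fun_eq_iff bounded_clinear_add unitary_opD(1)[OF U])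
  then have eq: "Psi_chi tens U \<rho>\<^sub>E chi \<rho>\<^sub>S = ptrace_E tens (U \<circ> T \<circ> adj U)"
    by (simp add: Psi_chi_def Phi_def I_chi_def tr scaleC_fun_def
        ptrace_E_add[OF tens fin nuclear_Phi[OF lin] nuclear_unitary_conj[OF U chi]])
  have "positive_op (U \<circ> T \<circ> adj U)"
    using T nuclear_bounded_clinear[OF UT] by (simp add: positive_op_iff o_def cinner_unitary_conj[OF U])
  then have "positive_op (Psi_chi tens U \<rho>\<^sub>E chi \<rho>\<^sub>S)"
    unfolding eq by (intro positive_op_ptrace_E tens fin UT)
  moreover have "op_trace (Psi_chi tens U \<rho>\<^sub>E chi \<rho>\<^sub>S) = 1"
    using op_trace_Psi_chi[OF assms(1), of \<rho>\<^sub>S] lin tr by (simp add: linear_ops_def)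
  ultimately show ?thesis by (rule positive_op_density[OF fin])
qed

end

theorem mainTheorem2:
  fixes tens :: "'s::chilbert_space \<Rightarrow> 'e::chilbert_space \<Rightarrow> 'k::chilbert_space"
    and U chi :: "'k \<Rightarrow> 'k"
    and \<rho>\<^sub>E :: "'e \<Rightarrow> 'e"
  assumes "\<exists>B :: 's set. finite B \<and> complex_vector.span B = UNIV"
    and "is_hilbert_tensor tens"
    and "unitary_op U"
    and "\<rho>\<^sub>E \<in> density_ops"
    and "hermitian_op chi"
    and "trace_class_op chi"
    and "ptrace_E tens chi = 0"
    and "ptrace_S tens chi = 0"
  shows "linear_map_on_ops (Psi_chi tens U \<rho>\<^sub>E chi)
    \<and> (\<forall>X\<in>trace_one_ops. Psi_chi tens U \<rho>\<^sub>E chi X = Phi_chi tens U \<rho>\<^sub>E chi X)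
    \<and> (\<forall>\<Lambda>. linear_map_on_ops \<Lambda> \<and> (\<forall>X\<in>trace_one_ops. \<Lambda> X = Phi_chi tens U \<rho>\<^sub>E chi X)
          \<longrightarrow> (\<forall>X\<in>linear_ops. \<Lambda> X = Psi_chi tens U \<rho>\<^sub>E chi X))
    \<and> (\<forall>X\<in>linear_ops. op_trace (Psi_chi tens U \<rho>\<^sub>E chi X) = op_trace X)
    \<and> Psi_chi tens U \<rho>\<^sub>E chi ` physical_domain tens \<rho>\<^sub>E chi \<subseteq> density_ops"
proof -
  have chi: "nuclear chi" by (rule nuclear_hermitian_trace_class[OF assms(5,6)])
  note lin = linear_map_on_ops_Psi_chi[OF assms(1-4) chi]
  have coincide: "Psi_chi tens U \<rho>\<^sub>E chi X = Phi_chi tens U \<rho>\<^sub>E chi X" if "X \<in> trace_one_ops" for X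
    using that by (simp add: trace_one_ops_def Psi_chi_def Phi_chi_def scaleC_fun_def)
  have "\<Lambda> X = Psi_chi tens U \<rho>\<^sub>E chi X"
    if "linear_map_on_ops \<Lambda>" "\<forall>X\<in>trace_one_ops. \<Lambda> X = Phi_chi tens U \<rho>\<^sub>E chi X" "X \<in> linear_ops" for \<Lambda> X
    by (rule linear_map_on_ops_unique[OF assms(1) that(1) lin _ that(3)]) (simp add: that(2) coincide)
  then show ?thesis
    using lin coincide op_trace_Psi_chi[OF assms(1-4) chi assms(7)]
      Psi_chi_physical_domain[OF assms(1-4) chi assms(7)] by blast
qed

end
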